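(* Let $a:\mathbb{N}\to\mathbb{R}$ satisfy $a(1)>0$, $a(n)\ge 0$ for all $n\ge 2$, and $a(n)=O(n^{\varepsilon})$ for every $\varepsilon>0$. Let $Z(s)=\sum_{n=1}^\infty a(n)n^{-s}$ for $s=\sigma+\mathrm{i}t$, $\sigma>1$, $t\in\mathbb{R}$, and for $\sigma>1$ let $X_\sigma$ be a real random variable whose characteristic function is $\mathcal{Z}_\sigma(t)=Z(\sigma+\mathrm{i}t)/Z(\sigma)$. Let $A(n)=(a^{\#}*a^{-1})(n)$, where $a^{\#}(n)=a(n)\log n$ and $a^{-1}$ is the Dirichlet inverse of $a$. Let $\sigma_0\ge 1$ and assume that $\mathcal{Z}_\sigma(t)\neq 0$ for all $\sigma>\sigma_0$ and $t\in\mathbb{R}$. Then for all $\sigma>\sigma_0$, $$\mathbb{E}[X_\sigma]=-\sum_{n=2}^\infty\frac{A(n)}{n^{\sigma}},\qquad \mathrm{Var}[X_\sigma]=\sum_{n=2}^\infty\frac{A(n)\log n}{n^{\sigma}}.$$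
   Context: Dirichlet convolution: $(a*b)(n)=\sum_{d\mid n}a(d)\,b(n/d)$. If $a(1)\ne0$, the Dirichlet inverse $a^{-1}$ is the unique arithmetic function with $(a*a^{-1})(1)=1$ and $(a*a^{-1})(n)=0$ for $n>1$. Under the stated hypotheses on $a$, for every $\sigma>1$ the function $t\mapsto \mathcal{Z}_\sigma(t)$ is the characteristic function of a probability distribution on $\mathbb{R}$. The infinite series are understood as convergent (not necessarily absolutely convergent) series. *)

theory Defs
  imports "HOL-Probability.Probability" "HOL-Library.Landau_Symbols"
begin

(* Arithmetic functions are functions on nat; their value at 0 is irrelevant and never used. *)

definition dirichlet_conv :: "(nat \<Rightarrow> real) \<Rightarrow> (nat \<Rightarrow> real) \<Rightarrow> nat \<Rightarrow> real" where
  "dirichlet_conv a b n = (\<Sum>d | d dvd n. a d * b (n div d))"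

definition is_dirichlet_inverse :: "(nat \<Rightarrow> real) \<Rightarrow> (nat \<Rightarrow> real) \<Rightarrow> bool" where
  "is_dirichlet_inverse a b \<longleftrightarrow>
     dirichlet_conv a b 1 = 1 \<and> (\<forall>n>1. dirichlet_conv a b n = 0)"

(* The condition b 0 = 0 only fixes the irrelevant value at 0, so that the function is unique
   on all of nat; existence and uniqueness for a 1 \<noteq> 0 are proved below. *)
definition dirichlet_inverse :: "(nat \<Rightarrow> real) \<Rightarrow> nat \<Rightarrow> real" where
  "dirichlet_inverse a = (THE b. is_dirichlet_inverse a b \<and> b 0 = 0)"

definition log_twist :: "(nat \<Rightarrow> real) \<Rightarrow> nat \<Rightarrow> real" where
  "log_twist a n = a n * ln (real n)"

definition A_fun :: "(nat \<Rightarrow> real) \<Rightarrow> nat \<Rightarrow> real" where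
  "A_fun a = dirichlet_conv (log_twist a) (dirichlet_inverse a)"

(* The summation index is shifted by one: the series starts at n = 1. *)
definition Z_series :: "(nat \<Rightarrow> real) \<Rightarrow> complex \<Rightarrow> complex" where
  "Z_series a s = (\<Sum>n. complex_of_real (a (Suc n)) * of_nat (Suc n) powr (- s))"

definition Z_normalized :: "(nat \<Rightarrow> real) \<Rightarrow> real \<Rightarrow> real \<Rightarrow> complex" where
  "Z_normalized a \<sigma> t = Z_series a (Complex \<sigma> t) / Z_series a (complex_of_real \<sigma>)"

lemma dirichlet_conv_split:
  assumes "n \<ge> 1"
  shows "dirichlet_conv a b n =
           a 1 * b n + (\<Sum>d | d dvd n \<and> d \<noteq> 1. a d * b (n div d))"
proof -
  have fin: "finite {d. d dvd n}" using assms by simp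
  have eq: "{d. d dvd n} - {1} = {d. d dvd n \<and> d \<noteq> 1}" by blast
  show ?thesis
    unfolding dirichlet_conv_def
    using sum.remove[OF fin, of 1 "\<lambda>d. a d * b (n div d)"] by (simp only: eq) simp
qed

lemma div_proper_less:
  fixes n d :: nat
  assumes "n \<ge> 1" "d dvd n" "d \<noteq> 1"
  shows "n div d < n"
proof -
  have "d > 1" using assms by (metis dvd_0_left_iff less_one linorder_neqE_nat not_one_le_zero)
  then show ?thesis using assms(1) by simp
qed

function dirichlet_inverse_rec :: "(nat \<Rightarrow> real) \<Rightarrow> nat \<Rightarrow> real" where
  "dirichlet_inverse_rec a n =
     (if n = 0 then 0 else
        ((if n = 1 then 1 else 0)
           - (\<Sum>d\<in>{d. d dvd n \<and> d \<noteq> 1 \<and> n \<noteq> 0}. a d * dirichlet_inverse_rec a (n div d))) / a 1)"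
  by pat_completeness auto
termination
  by (relation "Wellfounded.measure snd") (auto intro: div_proper_less)

declare dirichlet_inverse_rec.simps [simp del]

lemma dirichlet_inverse_unique:
  assumes "a 1 \<noteq> 0"
  shows "\<exists>!b. is_dirichlet_inverse a b \<and> b 0 = 0"
proof -
  have conv: "dirichlet_conv a (dirichlet_inverse_rec a) n = (if n = 1 then 1 else 0)"
    if "n \<ge> 1" for n
  proof -
    let ?S = "\<Sum>d | d dvd n \<and> d \<noteq> 1. a d * dirichlet_inverse_rec a (n div d)"
    have "dirichlet_inverse_rec a n = ((if n = 1 then 1 else 0) - ?S) / a 1"
      using that by (subst dirichlet_inverse_rec.simps) simp
    then have "a 1 * dirichlet_inverse_rec a n = (if n = 1 then 1 else 0) - ?S"
      using assms by simp
    then show ?thesis by (simp only: dirichlet_conv_split[OF that])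
  qed
  have "is_dirichlet_inverse a (dirichlet_inverse_rec a) \<and> dirichlet_inverse_rec a 0 = 0"
    using conv dirichlet_inverse_rec.simps[of a 0] by (simp add: is_dirichlet_inverse_def)
  moreover have "b = c"
    if b: "is_dirichlet_inverse a b \<and> b 0 = 0" and c: "is_dirichlet_inverse a c \<and> c 0 = 0" for b c
  proof
    fix n show "b n = c n"
    proof (induction n rule: less_induct)
      case (less n)
      show ?case
      proof (cases "n = 0")
        case True then show ?thesis using b c by simp
      next
        case False
        then have n1: "n \<ge> 1" by simp
        have eq: "dirichlet_conv a b n = dirichlet_conv a c n"
          using b c n1 unfolding is_dirichlet_inverse_def by (cases "n = 1") auto
        have "(\<Sum>d | d dvd n \<and> d \<noteq> 1. a d * b (n div d)) =
              (\<Sum>d | d dvd n \<and> d \<noteq> 1. a d * c (n div d))"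
          by (intro sum.cong refl) (simp add: less.IH div_proper_less[OF n1])
        then show ?thesis using eq assms by (simp add: dirichlet_conv_split[OF n1])
      qed
    qed
  qed
  ultimately show ?thesis by blast
qed

lemma is_dirichlet_inverse_dirichlet_inverse:
  assumes "a 1 \<noteq> 0"
  shows "is_dirichlet_inverse a (dirichlet_inverse a)" "dirichlet_inverse a 0 = 0"
  using theI'[OF dirichlet_inverse_unique[of a, OF assms]] by (auto simp: dirichlet_inverse_def)

end

theory Submission imports Defs "HOL-Complex_Analysis.Complex_Analysis" begin

text \<open>Write \<open>D f s\<close> for the Dirichlet series of \<open>f\<close> and \<open>f#\<close> for \<open>f(n) log n\<close>.

The probabilistic side is elementary. By uniqueness of characteristic functions, \<open>X \<sigma>\<close> takes the value
\<open>- log n\<close> with probability \<open>a(n) n powr (-\<sigma>) / D a \<sigma>\<close>. Hence its first two moments are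
\<open>- D (a#) \<sigma> / D a \<sigma>\<close> and \<open>D (a##) \<sigma> / D a \<sigma>\<close>. Since \<open>A * a = a#\<close> and the map \<open>f \<mapsto> f#\<close> is a
derivation of the Dirichlet convolution, \<open>D (a#) = D A * D a\<close> and \<open>D (a##) = D (A#) * D a + D A * D (a#)\<close>,
and the two formulas follow by algebra, provided that the series of \<open>A\<close> and \<open>A#\<close> converge at \<open>\<sigma>\<close>.

That proviso is the real content: it is known only that \<open>D a\<close> has no zeros in the half-plane
\<open>Re s > \<sigma>0\<close>, and the Dirichlet series of its inverse has to converge in all of that half-plane. In fact it
converges absolutely there (\<open>abs_conv_dirichlet_inverse\<close>), which is a form of Wiener's lemma for Dirichlet
series. Three ingredients carry the proof.

\<^item> Absence of zeros is uniform (\<open>dseries_bounded_below\<close>): if \<open>D f\<close> came arbitrarily close to 0 on a half-plane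
  \<open>Re s \<ge> \<sigma>1 > \<sigma>0\<close>, then a limit of vertical translates of \<open>D f\<close>, which exists by Montel's theorem, would
  have a zero there, and by Hurwitz's theorem so would a translate of \<open>D f\<close>.
\<^item> The coefficients of a Dirichlet series whose sum extends to a bounded holomorphic function satisfy
  Cauchy-type estimates (\<open>coefficient_bound\<close>), since they are means over vertical lines, and the line can be
  moved.
\<^item> Newman's argument: cut \<open>f\<close> off to a finitely supported \<open>p\<close> such that the remainder \<open>q = p - f\<close> has norm at most a
  third of the lower bound of \<open>D f\<close>. The powers of the convolution inverse \<open>u\<close> of \<open>p\<close> live on the smooth
  numbers, whose reciprocal powers are summable, so the coefficient estimate controls their norms
  (\<open>inverse_power_norm_bound\<close>) and the Neumann series \<open>\<Sum>k. q^k * u^(k+1)\<close>, which represents the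
  inverse of \<open>f\<close> (\<open>neumann_expansion\<close>), converges geometrically.\<close>

section \<open>Dirichlet convolution\<close>

lemma dirichlet_conv_0 [simp]: "dirichlet_conv f g 0 = 0"
  by (simp add: dirichlet_conv_def)

lemma finite_factor_pairs: "n > 0 \<Longrightarrow> finite {(d, e). d * e = (n::nat)}"
  by (rule finite_subset[of _ "{..n} \<times> {..n}"]) auto

text \<open>The symmetric form of the convolution: commutativity and associativity become reindexings of pairs and
triples of factors.\<close>
lemma dirichlet_conv_eq_factor_pairs:
  assumes "n > 0"
  shows "dirichlet_conv f g n = (\<Sum>(d, e) | d * e = n. f d * g e)"
  unfolding dirichlet_conv_def
  by (rule sum.reindex_bij_witness[of _ fst "\<lambda>d. (d, n div d)"]) (use assms in \<open>auto simp: ac_simps\<close>)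

lemma dirichlet_conv_commute: "dirichlet_conv f g = dirichlet_conv g f"
proof
  fix n show "dirichlet_conv f g n = dirichlet_conv g f n"
  proof (cases "n = 0")
    case False
    then show ?thesis
      by (simp add: dirichlet_conv_eq_factor_pairs)
         (rule sum.reindex_bij_witness[of _ prod.swap prod.swap], auto simp: ac_simps)
  qed simp
qed

lemma dirichlet_conv_assoc:
  "dirichlet_conv (dirichlet_conv f g) h = dirichlet_conv f (dirichlet_conv g h)"
proof
  fix n show "dirichlet_conv (dirichlet_conv f g) h n = dirichlet_conv f (dirichlet_conv g h) n"
  proof (cases "n = 0")
    case False
    then have n: "n > 0" by simp
    let ?D = "\<lambda>m. {(x, y). x * y = (m::nat)}"
    have fin: "finite (?D n)" "\<And>d e. d * e = n \<Longrightarrow> finite (?D d) \<and> finite (?D e)"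
      using n by (auto intro!: finite_factor_pairs)
    have "dirichlet_conv (dirichlet_conv f g) h n
        = (\<Sum>p\<in>?D n. \<Sum>q\<in>?D (fst p). f (fst q) * g (snd q) * h (snd p))"
      unfolding dirichlet_conv_eq_factor_pairs[OF n]
      by (rule sum.cong) (use n in \<open>auto simp: dirichlet_conv_eq_factor_pairs sum_distrib_right case_prod_unfold\<close>)
    also have "\<dots> = (\<Sum>(p, q)\<in>Sigma (?D n) (\<lambda>p. ?D (fst p)). f (fst q) * g (snd q) * h (snd p))"
      using fin by (subst sum.Sigma) auto
    also have "\<dots> = (\<Sum>(p, q)\<in>Sigma (?D n) (\<lambda>p. ?D (snd p)). f (fst p) * (g (fst q) * h (snd q)))"
      by (rule sum.reindex_bij_witness[of _ "\<lambda>((x, w), (y, z)). ((x * y, z), (x, y))"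
            "\<lambda>((w, z), (x, y)). ((x, y * z), (y, z))"]) (auto simp: ac_simps)
    also have "\<dots> = (\<Sum>p\<in>?D n. \<Sum>q\<in>?D (snd p). f (fst p) * (g (fst q) * h (snd q)))"
      using fin by (subst sum.Sigma) auto
    also have "\<dots> = dirichlet_conv f (dirichlet_conv g h) n"
      unfolding dirichlet_conv_eq_factor_pairs[OF n]
      by (rule sum.cong) (use n in \<open>auto simp: dirichlet_conv_eq_factor_pairs sum_distrib_left case_prod_unfold\<close>)
    finally show ?thesis .
  qed simp
qed

lemma dirichlet_conv_left_commute:
  "dirichlet_conv f (dirichlet_conv g h) = dirichlet_conv g (dirichlet_conv f h)"
  by (metis dirichlet_conv_assoc dirichlet_conv_commute)

lemmas dirichlet_conv_ac = dirichlet_conv_assoc dirichlet_conv_commute dirichlet_conv_left_commute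

lemma dirichlet_conv_add_right:
  "dirichlet_conv f (\<lambda>n. g n + h n) = (\<lambda>n. dirichlet_conv f g n + dirichlet_conv f h n)"
  by (simp add: dirichlet_conv_def fun_eq_iff sum.distrib algebra_simps)

definition dirichlet_one :: "nat \<Rightarrow> real" where
  "dirichlet_one n = (if n = 1 then 1 else 0)"

lemma dirichlet_conv_one_right:
  assumes "f 0 = 0"
  shows "dirichlet_conv f dirichlet_one = f"
proof
  fix n show "dirichlet_conv f dirichlet_one n = f n"
  proof (cases "n = 0")
    case False
    have "dirichlet_conv f dirichlet_one n = (\<Sum>d | d dvd n. if d = n then f n else 0)"
      unfolding dirichlet_conv_def using False
      by (intro sum.cong) (auto simp: dirichlet_one_def elim!: dvdE)
    then show ?thesis using False by simp
  qed (use assms in simp)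
qed

lemma dirichlet_conv_inverse:
  assumes "a 1 \<noteq> 0"
  shows "dirichlet_conv a (dirichlet_inverse a) = dirichlet_one"
proof
  fix n show "dirichlet_conv a (dirichlet_inverse a) n = dirichlet_one n"
    using is_dirichlet_inverse_dirichlet_inverse(1)[of a, OF assms]
    by (cases "n = 0"; cases "n = 1") (auto simp: is_dirichlet_inverse_def dirichlet_one_def)
qed

lemma dirichlet_conv_nonzeroE:
  assumes "dirichlet_conv f g n \<noteq> 0"
  obtains d e where "n = d * e" "n > 0" "f d \<noteq> 0" "g e \<noteq> 0"
proof -
  have n: "n > 0" using assms by (cases n) auto
  with assms have "(\<Sum>(d, e) | d * e = n. f d * g e) \<noteq> 0"
    by (simp add: dirichlet_conv_eq_factor_pairs)
  then obtain d e where "d * e = n" "f d * g e \<noteq> 0"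
    by (auto elim!: sum.not_neutral_contains_not_neutral)
  then show ?thesis using n by (intro that[of d e]) auto
qed

text \<open>The logarithm turns \<open>n = d * e\<close> into a sum, so the twist obeys the Leibniz rule. On the level of Dirichlet
series this is the product rule for the derivative \<open>d/ds\<close>.\<close>
lemma log_twist_conv:
  "log_twist (dirichlet_conv f g) n
     = dirichlet_conv (log_twist f) g n + dirichlet_conv f (log_twist g) n"
proof (cases "n = 0")
  case False
  then have n: "n > 0" by simp
  show ?thesis
    unfolding log_twist_def dirichlet_conv_eq_factor_pairs[OF n] sum_distrib_right
      sum.distrib[symmetric]
    using n by (intro sum.cong) (auto simp: ln_mult algebra_simps)
qed (simp add: log_twist_def)

fun dirichlet_power :: "(nat \<Rightarrow> real) \<Rightarrow> nat \<Rightarrow> nat \<Rightarrow> real" where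
  "dirichlet_power f 0 = dirichlet_one"
| "dirichlet_power f (Suc k) = dirichlet_conv f (dirichlet_power f k)"

section \<open>Products of absolutely convergent series over divisors\<close>

text \<open>The double series over all pairs \<open>(d, e)\<close> converges absolutely, so it may be grouped along the fibres of
\<open>(d, e) \<mapsto> d * e\<close>. The values at 0 have to vanish because the fibre over 0 is infinite.\<close>
lemma has_sum_divisor_sums:
  fixes F G :: "nat \<Rightarrow> 'a::{real_normed_field,banach}"
  assumes zero: "F 0 = 0" "G 0 = 0"
    and F: "summable (\<lambda>n. norm (F n))" and G: "summable (\<lambda>n. norm (G n))"
  shows "((\<lambda>n. \<Sum>d | d dvd n. F d * G (n div d)) has_sum suminf F * suminf G) UNIV"
proof -
  have hF: "(F has_sum suminf F) UNIV" and hG: "(G has_sum suminf G) UNIV"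
    using F G by (auto intro!: norm_summable_imp_has_sum summable_sums summable_norm_cancel)
  have aF: "(\<lambda>n. norm (F n)) summable_on UNIV" and aG: "(\<lambda>n. norm (G n)) summable_on UNIV"
    using F G by (auto intro!: norm_summable_imp_summable_on)
  have s: "(\<lambda>(d, e). F d * G e) summable_on UNIV \<times> UNIV"
  proof (rule abs_summable_summable, subst Infinite_Sum.abs_summable_on_Sigma_iff, intro conjI ballI)
    show "(\<lambda>d. norm (\<Sum>\<^sub>\<infinity>e. norm (case (d, e) of (d, e) \<Rightarrow> F d * G e))) summable_on UNIV"
      using aF aG by (simp add: norm_mult infsum_cmult_right summable_on_cmult_left abs_mult infsum_nonneg)
  qed (use aG in \<open>simp add: norm_mult summable_on_cmult_right\<close>)
  have "((\<lambda>(d, e). F d * G e) has_sum suminf F * suminf G) (UNIV \<times> UNIV)"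
    by (rule has_sum_SigmaI[where g = "\<lambda>d. F d * suminf G", OF _ _ s])
       (auto intro!: has_sum_cmult_right has_sum_cmult_left hF hG)
  also have "?this \<longleftrightarrow> ((\<lambda>(d, e). F d * G e) has_sum suminf F * suminf G) ({0<..} \<times> {0<..})"
    by (rule has_sum_cong_neutral) (use zero in \<open>auto intro!: Nat.gr0I\<close>)
  also have "\<dots> \<longleftrightarrow> ((\<lambda>(n, d). F d * G (n div d)) has_sum suminf F * suminf G)
      (Sigma {0<..} (\<lambda>n. {d. d dvd n}))"
    by (rule has_sum_reindex_bij_witness[of _ "\<lambda>(n, d). (d, n div d)" "\<lambda>(d, e). (d * e, d)"])
       (auto simp: dvd_pos_nat dvd_div_eq_0_iff dest: dvd_pos_nat dvd_imp_le intro: Nat.gr0I)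
  finally have "((\<lambda>n. \<Sum>d | d dvd n. F d * G (n div d)) has_sum suminf F * suminf G) {0<..}"
    by (rule has_sum_SigmaD[where g = "\<lambda>n. \<Sum>d | d dvd n. F d * G (n div d)"])
       (auto intro!: has_sum_finiteI)
  also have "?this \<longleftrightarrow> ?thesis"
    by (rule has_sum_cong_neutral) auto
  finally show ?thesis .
qed

lemma
  fixes F G :: "nat \<Rightarrow> 'a::{real_normed_field,banach}"
  defines "H \<equiv> \<lambda>n. \<Sum>d | d dvd n. F d * G (n div d)"
  assumes zero: "F 0 = 0" "G 0 = 0"
    and F: "summable (\<lambda>n. norm (F n))" and G: "summable (\<lambda>n. norm (G n))"
  shows sums_divisor_sums: "H sums (suminf F * suminf G)"
    and summable_norm_divisor_sums: "summable (\<lambda>n. norm (H n))"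
    and suminf_norm_divisor_sums_le: "(\<Sum>n. norm (H n)) \<le> (\<Sum>n. norm (F n)) * (\<Sum>n. norm (G n))"
proof -
  show "H sums (suminf F * suminf G)"
    unfolding H_def using has_sum_divisor_sums[OF zero F G] by (rule has_sum_imp_sums)
  let ?N = "\<lambda>n. \<Sum>d | d dvd n. norm (F d) * norm (G (n div d))"
  have N: "?N sums ((\<Sum>n. norm (F n)) * (\<Sum>n. norm (G n)))"
    using has_sum_divisor_sums[of "\<lambda>n. norm (F n)" "\<lambda>n. norm (G n)"] zero F G
    by (intro has_sum_imp_sums) simp
  have le: "norm (H n) \<le> ?N n" for n
    unfolding H_def by (rule sum_norm_le) (simp add: norm_mult)
  show s: "summable (\<lambda>n. norm (H n))"
    by (rule summable_comparison_test'[OF sums_summable[OF N], of 0]) (use le in auto)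
  show "(\<Sum>n. norm (H n)) \<le> (\<Sum>n. norm (F n)) * (\<Sum>n. norm (G n))"
    using suminf_le[OF le s sums_summable[OF N]] sums_unique[OF N] by simp
qed

section \<open>Absolutely convergent Dirichlet series\<close>

text \<open>All series range over every natural number, including 0: since \<open>0 powr x = 0\<close>, the term at 0 vanishes and the
value of an arithmetic function at 0 is immaterial.\<close>
definition abs_conv :: "real \<Rightarrow> (nat \<Rightarrow> real) \<Rightarrow> bool" where
  "abs_conv \<sigma> f \<longleftrightarrow> summable (\<lambda>n. \<bar>f n\<bar> * real n powr - \<sigma>)"

definition dirichlet_norm :: "real \<Rightarrow> (nat \<Rightarrow> real) \<Rightarrow> real" where
  "dirichlet_norm \<sigma> f = (\<Sum>n. \<bar>f n\<bar> * real n powr - \<sigma>)"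

definition dseries :: "(nat \<Rightarrow> real) \<Rightarrow> complex \<Rightarrow> complex" where
  "dseries f s = (\<Sum>n. of_real (f n) * of_nat n powr - s)"

definition dseries_real :: "(nat \<Rightarrow> real) \<Rightarrow> real \<Rightarrow> real" where
  "dseries_real f \<sigma> = (\<Sum>n. f n * real n powr - \<sigma>)"

lemma norm_dterm: "norm (of_real (f n) * of_nat n powr - s :: complex) = \<bar>f n\<bar> * real n powr - Re s"
  using norm_powr_real_powr[of "of_nat n" "-s"] by (simp add: norm_mult)

lemma powr_uminus_antimono: "\<sigma> \<le> \<tau> \<Longrightarrow> real n powr - \<tau> \<le> real n powr - \<sigma>"
  by (cases "n = 0") (simp_all add: powr_mono)

lemma abs_conv_mono:
  assumes "abs_conv \<sigma> f" "\<sigma> \<le> \<tau>"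
  shows "abs_conv \<tau> f" and "dirichlet_norm \<tau> f \<le> dirichlet_norm \<sigma> f"
proof -
  have le: "\<bar>f n\<bar> * real n powr - \<tau> \<le> \<bar>f n\<bar> * real n powr - \<sigma>" for n
    by (rule mult_left_mono[OF powr_uminus_antimono[OF assms(2)]]) simp
  show "abs_conv \<tau> f"
    unfolding abs_conv_def
    by (rule summable_comparison_test'[of "\<lambda>n. \<bar>f n\<bar> * real n powr - \<sigma>" 0])
       (use assms(1) le in \<open>simp_all add: abs_conv_def abs_mult\<close>)
  then show "dirichlet_norm \<tau> f \<le> dirichlet_norm \<sigma> f"
    unfolding dirichlet_norm_def using assms(1)
    by (intro suminf_le le) (simp_all add: abs_conv_def)
qed

lemma dirichlet_norm_nonneg: "abs_conv \<sigma> f \<Longrightarrow> dirichlet_norm \<sigma> f \<ge> 0"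
  unfolding dirichlet_norm_def abs_conv_def by (intro suminf_nonneg) auto

lemma summable_norm_dterm:
  "abs_conv \<sigma> f \<Longrightarrow> \<sigma> \<le> Re s \<Longrightarrow> summable (\<lambda>n. norm (of_real (f n) * of_nat n powr - s :: complex))"
  using abs_conv_mono(1)[of \<sigma> f "Re s"] unfolding norm_dterm abs_conv_def by simp

lemma dseries_sums:
  "abs_conv \<sigma> f \<Longrightarrow> \<sigma> \<le> Re s \<Longrightarrow> (\<lambda>n. of_real (f n) * of_nat n powr - s) sums dseries f s"
  unfolding dseries_def by (intro summable_sums summable_norm_cancel[OF summable_norm_dterm])

lemma norm_dseries_le:
  assumes "abs_conv \<sigma> f" "\<sigma> \<le> Re s"
  shows "norm (dseries f s) \<le> dirichlet_norm \<sigma> f"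
proof -
  have "norm (dseries f s) \<le> dirichlet_norm (Re s) f"
    using summable_norm[OF summable_norm_dterm[OF assms]]
    unfolding dseries_def dirichlet_norm_def norm_dterm .
  then show ?thesis using abs_conv_mono(2)[OF assms] by simp
qed

lemma dseries_real_summable:
  assumes "abs_conv \<sigma> f"
  shows "summable (\<lambda>n. f n * real n powr - \<sigma>)"
  by (rule summable_rabs_cancel) (use assms in \<open>simp add: abs_mult abs_conv_def\<close>)

lemma dseries_of_real:
  assumes "abs_conv \<sigma> f"
  shows "dseries f (of_real \<sigma>) = of_real (dseries_real f \<sigma>)"
proof -
  have "of_nat n powr - complex_of_real \<sigma> = of_real (real n powr - \<sigma>)" for n
    using powr_of_real[of "real n" "-\<sigma>"] by simp
  then show ?thesis
    unfolding dseries_def dseries_real_def suminf_of_real[OF dseries_real_summable[OF assms]] by simp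
qed

lemma powr_uminus_divisor:
  assumes "d dvd n" "n > 0"
  shows "of_nat n powr - s = of_nat d powr - s * (of_nat (n div d) powr - s :: complex)"
proof -
  obtain k where "n = d * k" using assms(1) by blast
  moreover have "(of_nat d * of_nat k) powr - s = of_nat d powr - s * (of_nat k powr - s :: complex)"
    by (rule powr_times_real) simp_all
  ultimately show ?thesis using assms(2) by simp
qed

text \<open>The weight \<open>n powr (-s)\<close> is completely multiplicative, so the weighted convolution is a divisor sum of weighted terms.\<close>
lemma dirichlet_conv_term:
  "of_real (dirichlet_conv f g n) * of_nat n powr - s
    = (\<Sum>d | d dvd n. (of_real (f d) * of_nat d powr - s)
         * (of_real (g (n div d)) * of_nat (n div d) powr - s) :: complex)"
proof (cases "n = 0")
  case False
  have "of_real (dirichlet_conv f g n) * of_nat n powr - s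
      = (\<Sum>d | d dvd n. of_real (f d * g (n div d)) * (of_nat n powr - s :: complex))"
    unfolding dirichlet_conv_def by (simp add: sum_distrib_right)
  also have "\<dots> = (\<Sum>d | d dvd n. (of_real (f d) * of_nat d powr - s)
         * (of_real (g (n div d)) * of_nat (n div d) powr - s) :: complex)"
  proof (intro sum.cong refl)
    fix d assume "d \<in> {d. d dvd n}"
    then show "of_real (f d * g (n div d)) * of_nat n powr - s
        = (of_real (f d) * of_nat d powr - s)
         * (of_real (g (n div d)) * of_nat (n div d) powr - s :: complex)"
      using False by (subst powr_uminus_divisor[of d n s]) simp_all
  qed
  finally show ?thesis .
qed simp

lemma
  assumes f: "abs_conv \<sigma> f" and g: "abs_conv \<sigma> g"
  shows abs_conv_conv: "abs_conv \<sigma> (dirichlet_conv f g)"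
    and dirichlet_norm_conv_le:
      "dirichlet_norm \<sigma> (dirichlet_conv f g) \<le> dirichlet_norm \<sigma> f * dirichlet_norm \<sigma> g"
    and dseries_conv:
      "\<And>s. \<sigma> \<le> Re s \<Longrightarrow> dseries (dirichlet_conv f g) s = dseries f s * dseries g s"
proof -
  let ?t = "\<lambda>f s n. of_real (f n) * of_nat n powr - s :: complex"
  have zero: "?t f s 0 = 0" for f s by simp
  note fg = summable_norm_dterm[OF f, of "of_real \<sigma>"] summable_norm_dterm[OF g, of "of_real \<sigma>"]
  show "abs_conv \<sigma> (dirichlet_conv f g)"
    using summable_norm_divisor_sums[of "?t f (of_real \<sigma>)" "?t g (of_real \<sigma>)", OF zero[of f "of_real \<sigma>"] zero[of g "of_real \<sigma>"]] fg
    unfolding dirichlet_conv_term[symmetric] norm_dterm abs_conv_def by simp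
  show "dirichlet_norm \<sigma> (dirichlet_conv f g) \<le> dirichlet_norm \<sigma> f * dirichlet_norm \<sigma> g"
    using suminf_norm_divisor_sums_le[of "?t f (of_real \<sigma>)" "?t g (of_real \<sigma>)", OF zero[of f "of_real \<sigma>"] zero[of g "of_real \<sigma>"]] fg
    unfolding dirichlet_conv_term[symmetric] norm_dterm dirichlet_norm_def by simp
  show "dseries (dirichlet_conv f g) s = dseries f s * dseries g s" if "\<sigma> \<le> Re s" for s
    using sums_divisor_sums[of "?t f s" "?t g s", OF zero[of f s] zero[of g s]
        summable_norm_dterm[OF f that] summable_norm_dterm[OF g that]]
    unfolding dirichlet_conv_term[symmetric] dseries_def by (simp add: sums_iff)
qed

lemma dseries_real_conv:
  assumes "abs_conv \<sigma> f" "abs_conv \<sigma> g"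
  shows "dseries_real (dirichlet_conv f g) \<sigma> = dseries_real f \<sigma> * dseries_real g \<sigma>"
proof -
  have "complex_of_real (dseries_real (dirichlet_conv f g) \<sigma>)
      = of_real (dseries_real f \<sigma> * dseries_real g \<sigma>)"
    using dseries_conv[OF assms, of "of_real \<sigma>"]
    by (simp add: dseries_of_real[OF assms(1)] dseries_of_real[OF assms(2)]
          dseries_of_real[OF abs_conv_conv[OF assms]])
  then show ?thesis by (simp only: of_real_eq_iff)
qed

lemma abs_conv_one: "abs_conv \<sigma> dirichlet_one"
  and dirichlet_norm_one: "dirichlet_norm \<sigma> dirichlet_one = 1"
  and dseries_one: "dseries dirichlet_one s = 1"
proof -
  have "(\<lambda>n. \<bar>dirichlet_one n\<bar> * real n powr - \<sigma>) = (\<lambda>n. if n = 1 then 1 else 0)"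
    "(\<lambda>n. of_real (dirichlet_one n) * of_nat n powr - s) = (\<lambda>n. if n = 1 then 1 else 0 :: complex)"
    by (rule ext, simp add: dirichlet_one_def)+
  moreover have "(\<lambda>n. if n = (1::nat) then 1 else 0 :: real) sums 1"
    "(\<lambda>n. if n = (1::nat) then 1 else 0 :: complex) sums 1"
    using sums_single[of 1 "\<lambda>_. 1 :: real"] sums_single[of 1 "\<lambda>_. 1 :: complex"] by auto
  ultimately show "abs_conv \<sigma> dirichlet_one" "dirichlet_norm \<sigma> dirichlet_one = 1"
    "dseries dirichlet_one s = 1"
    by (simp_all add: abs_conv_def dirichlet_norm_def dseries_def sums_iff)
qed

lemma
  assumes f: "abs_conv \<sigma> f"
  shows abs_conv_power: "abs_conv \<sigma> (dirichlet_power f k)"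
    and dirichlet_norm_power_le: "dirichlet_norm \<sigma> (dirichlet_power f k) \<le> dirichlet_norm \<sigma> f ^ k"
    and dseries_power: "\<And>s. \<sigma> \<le> Re s \<Longrightarrow> dseries (dirichlet_power f k) s = dseries f s ^ k"
proof -
  show c: "abs_conv \<sigma> (dirichlet_power f k)" for k
    by (induction k) (simp_all add: abs_conv_one f abs_conv_conv)
  show "dirichlet_norm \<sigma> (dirichlet_power f k) \<le> dirichlet_norm \<sigma> f ^ k"
  proof (induction k)
    case (Suc k)
    show ?case
      using dirichlet_norm_conv_le[OF f c[of k]] mult_left_mono[OF Suc dirichlet_norm_nonneg[OF f]]
      by simp
  qed (simp add: dirichlet_norm_one)
  show "dseries (dirichlet_power f k) s = dseries f s ^ k" if "\<sigma> \<le> Re s" for s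
    by (induction k) (simp_all add: dseries_one dseries_conv[OF f c that])
qed

lemma dseries_diff:
  assumes "abs_conv \<sigma> f" "abs_conv \<sigma> g" "\<sigma> \<le> Re s"
  shows "dseries (\<lambda>n. f n - g n) s = dseries f s - dseries g s"
  using sums_diff[OF dseries_sums[OF assms(1,3)] dseries_sums[OF assms(2,3)]]
  unfolding dseries_def by (simp add: sums_iff algebra_simps)

lemma abs_conv_finite_support:
  assumes "\<And>n. n > N \<Longrightarrow> f n = 0"
  shows "abs_conv \<sigma> f"
  unfolding abs_conv_def using assms by (intro summable_finite[of "{..N}"]) auto

text \<open>Any positive shift of the abscissa pays for a logarithm.\<close>
lemma abs_conv_log_twist:
  assumes "abs_conv \<sigma> f" "\<sigma> < \<tau>"
  shows "abs_conv \<tau> (log_twist f)"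
  unfolding abs_conv_def
proof (rule summable_comparison_test'[of "\<lambda>n. (\<bar>f n\<bar> * real n powr - \<sigma>) * (1 / (\<tau> - \<sigma>))" 0])
  show "norm (\<bar>log_twist f n\<bar> * real n powr - \<tau>) \<le> (\<bar>f n\<bar> * real n powr - \<sigma>) * (1 / (\<tau> - \<sigma>))" for n
  proof (cases "n = 0")
    case False
    have "ln (real n) \<le> real n powr (\<tau> - \<sigma>) / (\<tau> - \<sigma>)"
      using ln_powr_bound[of "real n" "\<tau> - \<sigma>"] assms(2) False by simp
    then have "\<bar>f n\<bar> * ln (real n) * real n powr - \<tau>
        \<le> \<bar>f n\<bar> * (real n powr (\<tau> - \<sigma>) / (\<tau> - \<sigma>)) * real n powr - \<tau>"
      by (intro mult_right_mono mult_left_mono) auto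
    also have "\<dots> = (\<bar>f n\<bar> * real n powr - \<sigma>) * (1 / (\<tau> - \<sigma>))"
      by (simp add: powr_diff powr_minus field_simps False)
    finally show ?thesis using False by (simp add: log_twist_def abs_mult)
  qed simp
qed (use assms in \<open>auto simp: abs_conv_def intro!: summable_mult2\<close>)

lemma abs_conv_bound:
  assumes "\<And>X. (\<Sum>n\<le>X. \<bar>f n\<bar> * real n powr - \<sigma>) \<le> C"
  shows "abs_conv \<sigma> f" "dirichlet_norm \<sigma> f \<le> C"
proof -
  show c: "abs_conv \<sigma> f" unfolding abs_conv_def
    by (rule bounded_imp_summable[where B = C]) (use assms in auto)
  show "dirichlet_norm \<sigma> f \<le> C"
    unfolding dirichlet_norm_def
  proof (rule suminf_le_const[OF c[unfolded abs_conv_def]])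
    fix N
    have "(\<Sum>n<N. \<bar>f n\<bar> * real n powr - \<sigma>) \<le> (\<Sum>n\<le>N. \<bar>f n\<bar> * real n powr - \<sigma>)"
      by (intro sum_mono2) auto
    with assms[of N] show "(\<Sum>n<N. \<bar>f n\<bar> * real n powr - \<sigma>) \<le> C" by linarith
  qed
qed

lemma sum_le_dirichlet_norm:
  assumes "abs_conv \<sigma> f" "finite A"
  shows "(\<Sum>n\<in>A. \<bar>f n\<bar> * real n powr - \<sigma>) \<le> dirichlet_norm \<sigma> f"
  using assms unfolding abs_conv_def dirichlet_norm_def by (intro sum_le_suminf) auto

lemma dseries_holomorphic:
  assumes "abs_conv \<sigma> f"
  shows "dseries f holomorphic_on {s. Re s > \<sigma>}"
proof (rule holomorphic_uniform_sequence[of _ "\<lambda>N s. \<Sum>n<N. of_real (f n) * of_nat n powr - s"])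
  show "open {s. Re s > \<sigma>}" by (rule open_halfspace_Re_gt)
  show "(\<lambda>s. \<Sum>n<N. of_real (f n) * of_nat n powr - s) holomorphic_on {s. Re s > \<sigma>}" for N
  proof (intro holomorphic_on_sum)
    show "(\<lambda>s. of_real (f n) * of_nat n powr - s) holomorphic_on {s. Re s > \<sigma>}" for n
    proof (cases "n = 0")
      case False
      then have "(\<lambda>s. of_real (f n) * of_nat n powr - s) = (\<lambda>s. of_real (f n) * exp (- s * Ln (of_nat n)))"
        by (simp add: powr_def fun_eq_iff)
      then show ?thesis by (auto intro!: holomorphic_intros)
    qed simp
  qed
  fix x assume x: "x \<in> {s. Re s > \<sigma>}"
  define d where "d = (Re x - \<sigma>) / 2"
  have d: "d > 0" "\<sigma> \<le> Re s" "\<sigma> < Re s" if "s \<in> cball x d" for s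
    using that x abs_Re_le_cmod[of "x - s"] by (simp_all add: d_def dist_norm abs_le_iff field_simps)
  have "uniform_limit (cball x d) (\<lambda>N s. \<Sum>n<N. of_real (f n) * of_nat n powr - s) (dseries f) sequentially"
    unfolding dseries_def[abs_def]
  proof (rule Weierstrass_m_test)
    show "norm (of_real (f n) * of_nat n powr - s :: complex) \<le> \<bar>f n\<bar> * real n powr - \<sigma>"
      if "s \<in> cball x d" for n s
    proof -
      have "\<sigma> \<le> Re s" using d(2)[OF that] .
      then show ?thesis
        unfolding norm_dterm by (intro mult_left_mono powr_uminus_antimono) auto
    qed
    show "summable (\<lambda>n. \<bar>f n\<bar> * real n powr - \<sigma>)"
      using assms by (simp add: abs_conv_def)
  qed
  moreover have "d > 0" "cball x d \<subseteq> {s. Re s > \<sigma>}"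
    using d x by (auto simp: d_def)
  ultimately show "\<exists>d>0. cball x d \<subseteq> {s. Re s > \<sigma>} \<and>
     uniform_limit (cball x d) (\<lambda>N s. \<Sum>n<N. of_real (f n) * of_nat n powr - s) (dseries f) sequentially"
    by (intro exI[of _ d] conjI)
qed

section \<open>Truncation\<close>

lemma small_tail:
  assumes f: "abs_conv \<sigma> f" and \<eta>: "\<eta> > 0"
  obtains N where "N \<ge> M" "dirichlet_norm \<sigma> (\<lambda>n. if n \<le> N then 0 else f n) \<le> \<eta>"
proof -
  let ?t = "\<lambda>n. \<bar>f n\<bar> * real n powr - \<sigma>"
  obtain N0 where N0: "\<And>n. n \<ge> N0 \<Longrightarrow> norm (\<Sum>i. ?t (i + n)) < \<eta>"
    using suminf_exist_split[OF \<eta> f[unfolded abs_conv_def]] by blast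
  define N where "N = max N0 M"
  let ?g = "\<lambda>n. \<bar>if n \<le> N then 0 else f n\<bar> * real n powr - \<sigma>"
  have sg: "summable ?g"
  proof (rule summable_comparison_test'[of ?t 0])
    show "summable ?t" using f by (simp add: abs_conv_def)
  qed (simp add: abs_mult)
  have "suminf ?g = (\<Sum>i. ?g (i + Suc N)) + sum ?g {..<Suc N}"
    by (rule suminf_split_initial_segment[OF sg])
  also have "sum ?g {..<Suc N} = 0" by (intro sum.neutral) auto
  also have "(\<lambda>i. ?g (i + Suc N)) = (\<lambda>i. ?t (i + Suc N))" by (simp add: fun_eq_iff)
  finally have "dirichlet_norm \<sigma> (\<lambda>n. if n \<le> N then 0 else f n) = (\<Sum>i. ?t (i + Suc N))"
    by (simp add: dirichlet_norm_def)
  moreover have "norm (\<Sum>i. ?t (i + Suc N)) < \<eta>"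
    by (rule N0) (simp add: N_def)
  ultimately show ?thesis by (intro that[of N]) (auto simp: N_def)
qed

lemma abs_conv_restrict:
  assumes "abs_conv \<sigma> f"
  shows "abs_conv \<sigma> (\<lambda>n. if P n then f n else 0)"
  unfolding abs_conv_def
  by (rule summable_comparison_test'[of "\<lambda>n. \<bar>f n\<bar> * real n powr - \<sigma>" 0])
     (use assms in \<open>simp_all add: abs_conv_def abs_mult\<close>)

lemma abs_conv_restrict':
  assumes "abs_conv \<sigma> f"
  shows "abs_conv \<sigma> (\<lambda>n. if P n then 0 else f n)"
proof -
  have "(\<lambda>n. if P n then 0 else f n) = (\<lambda>n. if \<not> P n then f n else 0)" by auto
  then show ?thesis using abs_conv_restrict[OF assms, of "\<lambda>n. \<not> P n"] by metis
qed

lemma dseries_split: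
  assumes "abs_conv \<sigma> f" "\<sigma> \<le> Re s"
  shows "dseries f s = dseries (\<lambda>n. if P n then f n else 0) s + dseries (\<lambda>n. if P n then 0 else f n) s"
proof -
  have "(\<lambda>n. f n - (if P n then f n else 0)) = (\<lambda>n. if P n then 0 else f n)" by auto
  then show ?thesis
    using dseries_diff[OF assms(1) abs_conv_restrict[OF assms(1), of P] assms(2)] by simp
qed

text \<open>For \<open>n \<ge> 2\<close>, moving the abscissa from \<open>\<sigma>\<close> to \<open>B\<close> gains at least a factor \<open>2 powr (\<sigma> - B)\<close>. So far to
the right the first coefficient dominates all others together.\<close>
lemma far_tail_small:
  assumes f: "abs_conv \<sigma> f" and \<eta>: "\<eta> > 0"
  obtains B where "B \<ge> \<sigma>" "dirichlet_norm B (\<lambda>n. if n \<le> 1 then 0 else f n) \<le> \<eta>"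
proof -
  define D where "D = dirichlet_norm \<sigma> f"
  have D0: "D \<ge> 0" unfolding D_def by (rule dirichlet_norm_nonneg[OF f])
  have "((\<lambda>B. 2 powr (\<sigma> - B) * D) \<longlongrightarrow> 0) at_top" by real_asymp
  then have "eventually (\<lambda>B. 2 powr (\<sigma> - B) * D < \<eta> \<and> B \<ge> \<sigma>) at_top"
    using \<eta> by (intro eventually_conj order_tendstoD(2) eventually_ge_at_top)
  then obtain B where B: "2 powr (\<sigma> - B) * D < \<eta>" "B \<ge> \<sigma>"
    using eventually_happens by force
  let ?f = "\<lambda>n. if n \<le> 1 then 0 else f n"
  have le: "\<bar>?f n\<bar> * real n powr - B \<le> 2 powr (\<sigma> - B) * (\<bar>f n\<bar> * real n powr - \<sigma>)" for n
  proof (cases "n \<le> 1")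
    case False
    have "real n powr - B = real n powr (\<sigma> - B) * real n powr - \<sigma>"
      by (simp flip: powr_add)
    also have "\<dots> \<le> 2 powr (\<sigma> - B) * real n powr - \<sigma>"
      using False B(2) by (intro mult_right_mono powr_mono2') auto
    finally have "\<bar>f n\<bar> * real n powr - B \<le> \<bar>f n\<bar> * (2 powr (\<sigma> - B) * real n powr - \<sigma>)"
      by (intro mult_left_mono) auto
    then show ?thesis using False by (simp add: mult_ac)
  qed simp
  have "dirichlet_norm B ?f \<le> (\<Sum>n. 2 powr (\<sigma> - B) * (\<bar>f n\<bar> * real n powr - \<sigma>))"
    unfolding dirichlet_norm_def
  proof (rule suminf_le[OF le])
    show "summable (\<lambda>n. \<bar>?f n\<bar> * real n powr - B)"
      using abs_conv_restrict'[OF abs_conv_mono(1)[OF f B(2)], of "\<lambda>n. n \<le> 1"] by (simp add: abs_conv_def)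
  qed (use f in \<open>simp add: abs_conv_def summable_mult\<close>)
  also have "\<dots> = 2 powr (\<sigma> - B) * D"
    unfolding D_def dirichlet_norm_def by (rule suminf_mult) (use f in \<open>simp add: abs_conv_def\<close>)
  finally show ?thesis using B by (intro that[of B]) auto
qed

lemma dseries_finite:
  assumes "\<And>n. n > N \<Longrightarrow> f n = 0"
  shows "dseries f s = (\<Sum>n\<in>{1..N}. of_real (f n) * of_nat n powr - s)"
proof -
  have "dseries f s = (\<Sum>n\<in>{..N}. of_real (f n) * of_nat n powr - s)"
    unfolding dseries_def using assms by (intro suminf_finite) auto
  also have "\<dots> = (\<Sum>n\<in>{1..N}. of_real (f n) * of_nat n powr - s)"
  proof (rule sum.mono_neutral_right)
    show "\<forall>i\<in>{..N} - {1..N}. of_real (f i) * of_nat i powr - s = (0::complex)"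
    proof
      fix i assume "i \<in> {..N} - {1..N}"
      then have "i = 0" by auto
      then show "of_real (f i) * of_nat i powr - s = (0::complex)" by simp
    qed
  qed auto
  finally show ?thesis .
qed

lemma dseries_near_first:
  assumes f: "abs_conv \<sigma> f"
    and small: "dirichlet_norm \<sigma> (\<lambda>n. if n \<le> 1 then 0 else f n) \<le> \<bar>f 1\<bar> / 2"
    and s: "\<sigma> \<le> Re s"
  shows "norm (dseries f s) \<ge> \<bar>f 1\<bar> / 2"
proof -
  have "dseries (\<lambda>n. if n \<le> 1 then f n else 0) s = of_real (f 1)"
    by (subst dseries_finite[of 1]) auto
  then have "dseries f s = of_real (f 1) + dseries (\<lambda>n. if n \<le> 1 then 0 else f n) s"
    using dseries_split[OF f s, of "\<lambda>n. n \<le> 1"] by simp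
  moreover have "norm (dseries (\<lambda>n. if n \<le> 1 then 0 else f n) s) \<le> \<bar>f 1\<bar> / 2"
    using norm_dseries_le[OF abs_conv_restrict'[OF f] s, of "\<lambda>n. n \<le> 1"] small by linarith
  ultimately show ?thesis
    using norm_diff_ineq[of "of_real (f 1)" "dseries (\<lambda>n. if n \<le> 1 then 0 else f n) s"] by simp
qed

section \<open>Coefficient estimates for bounded Dirichlet series\<close>

lemma le_if_le_add_vanishing:
  fixes a b E :: real
  assumes "\<And>T. T > 0 \<Longrightarrow> a \<le> b + E / T" "E \<ge> 0"
  shows "a \<le> b"
proof (rule field_le_epsilon)
  fix e :: real assume e: "e > 0"
  have "E / (E / e + 1) \<le> e"
    using e assms(2) by (simp add: field_simps add_pos_nonneg)
  moreover have "E / e + 1 > 0" using e assms(2) by (simp add: add_nonneg_pos)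
  ultimately show "a \<le> b + e" using assms(1)[of "E / e + 1"] by linarith
qed

text \<open>On the line \<open>Re s = B\<close> the mean of \<open>h s * m powr s\<close> over \<open>|Im s| \<le> T\<close> tends to \<open>c m\<close>, because every other
term oscillates. By Cauchy's theorem the mean over \<open>Re s = \<sigma>\<close> differs from it only by the two horizontal
sides of a rectangle, which are \<open>O(1/T)\<close>, and there the integrand is at most \<open>K * m powr \<sigma>\<close>.
Instead of contour integrals the proof uses a primitive \<open>G\<close> of the integrand in the half-plane: an
integral along a side of the rectangle is a difference of values of \<open>G\<close>, bounded by the mean value inequality.\<close>
lemma coefficient_bound:
  assumes c: "abs_conv B c"
    and hol: "h holomorphic_on {s. Re s > \<sigma>'}" and \<sigma>: "\<sigma>' < \<sigma>" "\<sigma> \<le> B"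
    and K: "\<And>s. Re s \<ge> \<sigma> \<Longrightarrow> norm (h s) \<le> K"
    and eq: "\<And>s. Re s = B \<Longrightarrow> h s = dseries c s"
    and m: "m > 0"
  shows "\<bar>c m\<bar> \<le> K * real m powr \<sigma>"
proof (rule field_le_epsilon)
  fix e :: real assume e: "e > 0"
  define w where "w = (\<lambda>s. exp (s * of_real (ln (real m))) :: complex)"
  define H where "H = {s. Re s > \<sigma>'}"
  have norm_w: "norm (w s) = real m powr Re s" for s
    using m by (simp add: w_def powr_def)
  have K0: "K \<ge> 0" by (rule order.trans[OF norm_ge_zero K[of "of_real \<sigma>"]]) simp
  obtain G where G: "\<And>s. s \<in> H \<Longrightarrow> (G has_field_derivative h s * w s) (at s within H)"
  proof (rule holomorphic_convex_primitive'[of H "\<lambda>s. h s * w s"])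
    show "(\<lambda>s. h s * w s) holomorphic_on H"
      using hol by (auto simp: w_def H_def intro!: holomorphic_intros)
  qed (auto simp: H_def convex_halfspace_Re_gt open_halfspace_Re_gt)
  obtain L where L: "L \<ge> m"
    "dirichlet_norm B (\<lambda>n. if n \<le> L then 0 else c n) \<le> e / real m powr B"
    using small_tail[OF c, of "e / real m powr B" m] e m by auto
  define l where "l = (\<lambda>n. ln (real m) - ln (real n))"
  have l0: "l n \<noteq> 0" if "n \<in> {1..L} - {m}" for n
    using that m by (auto simp: l_def)
  \<comment> \<open>\<open>P\<close> is an explicit primitive of the first \<open>L\<close> terms of the series times \<open>w\<close>; only the term \<open>n = m\<close> grows
      along the vertical line, the others are bounded by \<open>E2\<close>.\<close>
  define P where "P = (\<lambda>s. of_real (c m) * s + (\<Sum>n\<in>{1..L} - {m}. of_real (c n / l n) * exp (s * of_real (l n))) :: complex)"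
  define P' where "P' = (\<lambda>s. of_real (c m) + (\<Sum>n\<in>{1..L} - {m}. of_real (c n) * exp (s * of_real (l n))) :: complex)"
  have P: "(P has_field_derivative P' s) (at s within A)" for s A
    unfolding P_def P'_def by (auto intro!: derivative_eq_intros sum.cong simp: l0)
  have P'_eq: "P' s = dseries (\<lambda>n. if n \<le> L then c n else 0) s * w s" for s
  proof -
    have t: "of_nat n powr - s * w s = exp (s * of_real (l n))" if "n \<in> {1..L}" for n
      using that by (simp add: powr_def w_def l_def Ln_of_nat algebra_simps flip: exp_add)
    have "dseries (\<lambda>n. if n \<le> L then c n else 0) s
        = (\<Sum>n\<in>{1..L}. of_real (if n \<le> L then c n else 0) * of_nat n powr - s)"
      by (rule dseries_finite) simp
    then have "dseries (\<lambda>n. if n \<le> L then c n else 0) s * w s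
        = (\<Sum>n\<in>{1..L}. of_real (c n) * (of_nat n powr - s * w s))"
      by (simp add: sum_distrib_right mult.assoc)
    also have "\<dots> = (\<Sum>n\<in>{1..L}. of_real (c n) * exp (s * of_real (l n)))"
      by (intro sum.cong) (simp_all add: t)
    also have "\<dots> = P' s"
      unfolding P'_def using m L(1) by (subst sum.remove[of _ m]) (auto simp: l_def)
    finally show ?thesis ..
  qed
  have tail: "norm (h s * w s - P' s) \<le> e" if "Re s = B" for s
  proof -
    have "h s * w s - P' s = dseries (\<lambda>n. if n \<le> L then 0 else c n) s * w s"
      using dseries_split[OF c, of s "\<lambda>n. n \<le> L"] that by (simp add: eq P'_eq algebra_simps)
    moreover have "norm (dseries (\<lambda>n. if n \<le> L then 0 else c n) s) \<le> e / real m powr B"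
      using norm_dseries_le[OF abs_conv_restrict'[OF c], of s "\<lambda>n. n \<le> L"] that L(2) by simp
    ultimately show ?thesis
      using m that by (simp add: norm_mult norm_w field_simps)
  qed
  define E1 where "E1 = K * real m powr B * (B - \<sigma>)"
  define E2 where "E2 = (\<Sum>n\<in>{1..L} - {m}. \<bar>c n / l n\<bar> * exp (B * l n))"
  define E where "E = E1 + E2"
  have E0: "E \<ge> 0"
    unfolding E_def E1_def E2_def using K0 \<sigma> by (auto intro!: add_nonneg_nonneg sum_nonneg)
  show "\<bar>c m\<bar> \<le> K * real m powr \<sigma> + e"
  proof (rule le_if_le_add_vanishing[OF _ E0])
    fix T :: real assume T: "T > 0"
    have line: "convex {s. Re s = x}" for x
    proof -
      have "{s. Re s = x} = {s. Re s \<ge> x} \<inter> {s. Re s \<le> x}" by auto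
      then show ?thesis by (metis convex_Int convex_halfspace_Re_ge convex_halfspace_Re_le)
    qed
    have diffs: "Complex x T - Complex x (- T) = Complex 0 (2 * T)"
      "Complex B t - Complex \<sigma> t = Complex (B - \<sigma>) 0" for x t
      by (simp_all add: complex_eq_iff)
    have vert: "norm (F (Complex x T) - F (Complex x (- T))) \<le> b * (2 * T)"
      if "\<And>s. Re s = x \<Longrightarrow> (F has_field_derivative F' s) (at s within {s. Re s = x})"
        "\<And>s. Re s = x \<Longrightarrow> norm (F' s) \<le> b" for F F' :: "complex \<Rightarrow> complex" and x b
    proof -
      have "norm (F (Complex x T) - F (Complex x (- T))) \<le> b * norm (Complex x T - Complex x (- T))"
        by (rule field_differentiable_bound[of "{s. Re s = x}" F F'])
           (use that line in auto)
      also have "norm (Complex x T - Complex x (- T)) = 2 * T"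
        using T by (simp add: complex_norm diffs real_sqrt_mult)
      finally show ?thesis .
    qed
    have left: "norm (G (Complex \<sigma> T) - G (Complex \<sigma> (- T))) \<le> K * real m powr \<sigma> * (2 * T)"
    proof (rule vert)
      fix s assume s: "Re s = \<sigma>"
      show "(G has_field_derivative h s * w s) (at s within {s. Re s = \<sigma>})"
        by (rule has_field_derivative_subset[OF G]) (use s \<sigma> in \<open>auto simp: H_def\<close>)
      show "norm (h s * w s) \<le> K * real m powr \<sigma>"
        using K[of s] s by (auto simp: norm_mult norm_w intro!: mult_right_mono)
    qed
    have right: "norm ((G (Complex B T) - P (Complex B T)) - (G (Complex B (- T)) - P (Complex B (- T)))) \<le> e * (2 * T)"
    proof (rule vert)
      fix s assume s: "Re s = B"
      show "((\<lambda>s. G s - P s) has_field_derivative h s * w s - P' s) (at s within {s. Re s = B})"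
        by (rule DERIV_diff[OF has_field_derivative_subset[OF G] P]) (use s \<sigma> in \<open>auto simp: H_def\<close>)
      show "norm (h s * w s - P' s) \<le> e" by (rule tail[OF s])
    qed
    have horiz: "norm (G (Complex B t) - G (Complex \<sigma> t)) \<le> E1" for t
    proof -
      have "norm (G (Complex B t) - G (Complex \<sigma> t)) \<le> K * real m powr B * norm (Complex B t - Complex \<sigma> t)"
      proof (rule field_differentiable_bound[of "{s. Re s \<ge> \<sigma>} \<inter> {s. Re s \<le> B}" G "\<lambda>s. h s * w s"])
        show "convex ({s. Re s \<ge> \<sigma>} \<inter> {s. Re s \<le> B})"
          by (intro convex_Int convex_halfspace_Re_ge convex_halfspace_Re_le)
        fix s assume s: "s \<in> {s. Re s \<ge> \<sigma>} \<inter> {s. Re s \<le> B}"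
        show "(G has_field_derivative h s * w s) (at s within {s. Re s \<ge> \<sigma>} \<inter> {s. Re s \<le> B})"
          by (rule has_field_derivative_subset[OF G]) (use s \<sigma> in \<open>auto simp: H_def\<close>)
        have "real m powr Re s \<le> real m powr B"
          using s m by (intro powr_mono) auto
        then show "norm (h s * w s) \<le> K * real m powr B"
          using K[of s] s K0 unfolding norm_mult norm_w by (intro mult_mono) auto
      qed (use \<sigma> in auto)
      also have "norm (Complex B t - Complex \<sigma> t) = B - \<sigma>"
        using \<sigma> by (simp add: complex_norm diffs real_sqrt_mult)
      finally show ?thesis unfolding E1_def .
    qed
    define R where "R = (\<lambda>s. \<Sum>n\<in>{1..L} - {m}. of_real (c n / l n) * exp (s * of_real (l n)) :: complex)"
    have R: "norm (R (Complex B t)) \<le> E2" for t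
      unfolding R_def E2_def by (rule sum_norm_le) (simp add: norm_mult norm_divide)
    \<comment> \<open>Go around the rectangle: up the line \<open>Re s = B\<close> for the \<open>m\<close>-th term equals the tail error, the horizontal
        sides, the side on \<open>Re s = \<sigma>\<close>, and the oscillating terms.\<close>
    have main: "P (Complex B T) - P (Complex B (- T))
        = of_real (c m) * (Complex B T - Complex B (- T)) + (R (Complex B T) - R (Complex B (- T)))"
      unfolding P_def R_def by (simp add: algebra_simps)
    have "norm (of_real (c m) * (Complex B T - Complex B (- T))) = \<bar>c m\<bar> * (2 * T)"
      using T by (simp add: norm_mult complex_norm diffs real_sqrt_mult)
    moreover have "of_real (c m) * (Complex B T - Complex B (- T))
        = - ((G (Complex B T) - P (Complex B T)) - (G (Complex B (- T)) - P (Complex B (- T))))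
          + (G (Complex B T) - G (Complex \<sigma> T)) + (G (Complex \<sigma> T) - G (Complex \<sigma> (- T)))
          + (- (G (Complex B (- T)) - G (Complex \<sigma> (- T)))) + (- R (Complex B T)) + R (Complex B (- T))"
      using main by (simp add: algebra_simps)
    moreover have "norm (- x1 + x2 + x3 + (- x4) + (- x5) + x6)
        \<le> norm x1 + norm x2 + norm x3 + norm x4 + norm x5 + norm x6" for x1 x2 x3 x4 x5 x6 :: complex
      by (intro norm_triangle_mono) (simp_all only: norm_minus_cancel order_refl)
    ultimately have "\<bar>c m\<bar> * (2 * T) \<le> norm ((G (Complex B T) - P (Complex B T)) - (G (Complex B (- T)) - P (Complex B (- T))))
        + norm (G (Complex B T) - G (Complex \<sigma> T)) + norm (G (Complex \<sigma> T) - G (Complex \<sigma> (- T)))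
        + norm (G (Complex B (- T)) - G (Complex \<sigma> (- T))) + norm (R (Complex B T)) + norm (R (Complex B (- T)))"
      by metis
    also have "\<dots> \<le> e * (2 * T) + E1 + K * real m powr \<sigma> * (2 * T) + E1 + E2 + E2"
      by (intro add_mono left right horiz R)
    also have "\<dots> = (K * real m powr \<sigma> + e + E / T) * (2 * T)"
      using T by (simp add: E_def field_simps)
    finally show "\<bar>c m\<bar> \<le> K * real m powr \<sigma> + e + E / T"
      using T by simp
  qed
qed

section \<open>Absence of zeros is uniform\<close>

text \<open>Bohr's argument. Points \<open>z k\<close> where the series tends to 0 have bounded real parts, since the first
coefficient dominates far to the right. The translates that move \<open>z k\<close> to the real axis are uniformly
bounded, so a subsequence converges to some \<open>g\<close> that vanishes at a limit point of the real parts. None of the translates has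
a zero, so by Hurwitz's theorem \<open>g\<close> vanishes identically, which is impossible far to the right.\<close>
lemma dseries_bounded_below:
  assumes f: "\<And>\<sigma>. \<sigma> > \<sigma>0 \<Longrightarrow> abs_conv \<sigma> f" and f1: "f 1 \<noteq> 0"
    and nz: "\<And>s. Re s > \<sigma>0 \<Longrightarrow> dseries f s \<noteq> 0" and \<sigma>: "\<sigma> > \<sigma>0"
  obtains \<delta> where "\<delta> > 0" "\<And>s. Re s \<ge> \<sigma> \<Longrightarrow> norm (dseries f s) \<ge> \<delta>"
proof (rule ccontr)
  assume contra: "\<not> thesis"
  obtain B where B: "B \<ge> \<sigma>" "dirichlet_norm B (\<lambda>n. if n \<le> 1 then 0 else f n) \<le> \<bar>f 1\<bar> / 2"
    using far_tail_small[OF f[OF \<sigma>], of "\<bar>f 1\<bar> / 2"] f1 by auto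
  have far: "norm (dseries f s) \<ge> \<bar>f 1\<bar> / 2" if "Re s \<ge> B" for s
    using dseries_near_first[OF f B(2) that] B(1) \<sigma> by simp
  have "\<exists>s. Re s \<ge> \<sigma> \<and> norm (dseries f s) < min (inverse (real (Suc k))) (\<bar>f 1\<bar> / 2)" for k
  proof (rule ccontr)
    assume "\<not> ?thesis"
    then have "norm (dseries f s) \<ge> min (inverse (real (Suc k))) (\<bar>f 1\<bar> / 2)" if "Re s \<ge> \<sigma>" for s
      using that by (meson not_less)
    then show False using contra that[of "min (inverse (real (Suc k))) (\<bar>f 1\<bar> / 2)"] f1 by simp
  qed
  then obtain z where z: "\<And>k. Re (z k) \<ge> \<sigma>"
    "\<And>k. norm (dseries f (z k)) < min (inverse (real (Suc k))) (\<bar>f 1\<bar> / 2)"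
    by metis
  have zB: "Re (z k) \<le> B" for k
    using far[of "z k"] z(2)[of k] by (meson min.strict_boundedE not_less linear order.strict_trans2)
  define \<tau> where "\<tau> = (\<sigma>0 + \<sigma>) / 2"
  have \<tau>: "\<sigma>0 < \<tau>" "\<tau> < \<sigma>" using \<sigma> by (auto simp: \<tau>_def)
  define S where "S = {s. Re s > \<tau>}"
  define F where "F = (\<lambda>k s. dseries f (s + \<i> * of_real (Im (z k))))"
  have S: "open S" "connected S"
    unfolding S_def by (auto simp: open_halfspace_Re_gt convex_connected convex_halfspace_Re_gt)
  have holF: "F k holomorphic_on S" for k
  proof -
    have "(dseries f \<circ> (\<lambda>s. s + \<i> * of_real (Im (z k)))) holomorphic_on S"
      by (rule holomorphic_on_compose_gen[OF _ dseries_holomorphic[OF f[OF \<tau>(1)]]])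
         (auto simp: S_def intro!: holomorphic_intros)
    then show ?thesis by (simp add: F_def o_def)
  qed
  have bound: "norm (F k s) \<le> dirichlet_norm \<tau> f" if "s \<in> S" for k s
    unfolding F_def using that by (intro norm_dseries_le f \<tau>) (auto simp: S_def)
  obtain g r where g: "g holomorphic_on S" and r: "strict_mono (r :: nat \<Rightarrow> nat)"
    and ptw: "\<And>x. x \<in> S \<Longrightarrow> (\<lambda>n. F (r n) x) \<longlonglongrightarrow> g x"
    and unif: "\<And>K. compact K \<Longrightarrow> K \<subseteq> S \<Longrightarrow> uniform_limit K (F \<circ> r) g sequentially"
  proof (rule Montel[of S "range F" F])
    show "\<exists>B. \<forall>h\<in>range F. \<forall>z\<in>K. norm (h z) \<le> B" if "K \<subseteq> S" for K
      using bound that by blast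
  qed (use S holF in auto)
  define K where "K = complex_of_real ` {\<sigma>..B}"
  have K: "compact K" "K \<subseteq> S"
    using \<tau> by (auto simp: K_def S_def intro!: compact_continuous_image continuous_intros)
  define x where "x = (\<lambda>k. complex_of_real (Re (z (r k))))"
  have xK: "x k \<in> K" for k using z(1) zB by (auto simp: x_def K_def)
  obtain y q where y: "y \<in> K" and q: "strict_mono (q :: nat \<Rightarrow> nat)" and lim: "(x \<circ> q) \<longlonglongrightarrow> y"
    using K(1) xK unfolding compact_def by blast
  have "(\<lambda>k. g (x (q k))) \<longlonglongrightarrow> g y"
    using continuous_on_tendsto_compose[OF holomorphic_on_imp_continuous_on[OF g] lim]
      y xK K(2) by (auto simp: o_def subset_iff)
  moreover have "(\<lambda>k. F (r (q k)) (x (q k)) - g (x (q k))) \<longlonglongrightarrow> 0"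
  proof (rule tendstoI)
    fix e :: real assume "e > 0"
    with unif[OF K] have "\<forall>\<^sub>F n in sequentially. \<forall>x\<in>K. dist ((F \<circ> r) n x) (g x) < e"
      by (simp add: uniform_limit_iff)
    then have "\<forall>\<^sub>F n in sequentially. \<forall>x\<in>K. dist ((F \<circ> r) (q n) x) (g x) < e"
      using filterlim_subseq[OF q] by (rule eventually_compose_filterlim)
    then show "\<forall>\<^sub>F k in sequentially. dist (F (r (q k)) (x (q k)) - g (x (q k))) 0 < e"
      by eventually_elim (use xK in \<open>simp add: dist_norm\<close>)
  qed
  ultimately have "(\<lambda>k. F (r (q k)) (x (q k)) - g (x (q k)) + g (x (q k))) \<longlonglongrightarrow> 0 + g y"
    by (intro tendsto_add)
  then have lim1: "(\<lambda>k. F (r (q k)) (x (q k))) \<longlonglongrightarrow> g y" by simp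
  have "(\<lambda>k. F (r (q k)) (x (q k))) \<longlonglongrightarrow> 0"
  proof (rule Lim_null_comparison)
    show "(\<lambda>k. inverse (real (Suc (r (q k))))) \<longlonglongrightarrow> 0"
      using LIMSEQ_subseq_LIMSEQ[OF LIMSEQ_subseq_LIMSEQ[OF LIMSEQ_inverse_real_of_nat r] q]
      by (simp add: o_def)
    have "F (r (q k)) (x (q k)) = dseries f (z (r (q k)))" for k
      unfolding F_def x_def by (intro arg_cong[where f = "dseries f"]) (simp add: complex_eq_iff)
    then show "\<forall>\<^sub>F k in sequentially. norm (F (r (q k)) (x (q k))) \<le> inverse (real (Suc (r (q k))))"
      using z(2) by (intro always_eventually allI) (simp add: less_imp_le)
  qed
  with lim1 have gy: "g y = 0" by (rule LIMSEQ_unique)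
  have yS: "y \<in> S" using y K by auto
  have "g constant_on S"
  proof (rule ccontr)
    assume nc: "\<not> g constant_on S"
    have "g y \<noteq> 0"
    proof (rule Hurwitz_no_zeros[OF S _ g _ nc _ yS, of "F \<circ> r"])
      show "(F \<circ> r) n holomorphic_on S" for n using holF by simp
      show "(F \<circ> r) n s \<noteq> 0" if "s \<in> S" for n s
        using that \<tau> by (auto simp: F_def S_def intro!: nz)
    qed (use unif in auto)
    with gy show False by simp
  qed
  then have "g (of_real B) = g y"
    using yS B(1) \<tau> unfolding constant_on_def S_def by auto
  moreover have "norm (g (of_real B)) \<ge> \<bar>f 1\<bar> / 2"
  proof (rule tendsto_lowerbound[OF tendsto_norm[OF ptw]])
    show "\<forall>\<^sub>F n in sequentially. \<bar>f 1\<bar> / 2 \<le> norm (F (r n) (of_real B))"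
      unfolding F_def by (intro always_eventually allI far) simp
  qed (use B(1) \<tau> in \<open>auto simp: S_def\<close>)
  ultimately show False using gy f1 by simp
qed

section \<open>Smooth numbers\<close>

text \<open>The products of integers from \<open>{2..j + 1}\<close>, that is, the numbers without a prime factor above \<open>j + 1\<close>. Adjoining
one integer at a time, prime or not, turns closure under multiplication and summability into inductions on \<open>j\<close>.\<close>
fun smooth_numbers :: "nat \<Rightarrow> nat set" where
  "smooth_numbers 0 = {1}"
| "smooth_numbers (Suc j) = (\<lambda>(x, i). x * (j + 2) ^ i) ` (smooth_numbers j \<times> UNIV)"

lemma smooth_numbers_Suc_I: "x \<in> smooth_numbers j \<Longrightarrow> x * (j + 2) ^ i \<in> smooth_numbers (Suc j)"
  by force

lemma smooth_numbers_Suc_E: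
  assumes "n \<in> smooth_numbers (Suc j)"
  obtains x i where "x \<in> smooth_numbers j" "n = x * (j + 2) ^ i"
  using assms by auto

lemma smooth_numbers_mono: "smooth_numbers j \<subseteq> smooth_numbers (Suc j)"
proof
  fix x assume "x \<in> smooth_numbers j"
  then show "x \<in> smooth_numbers (Suc j)" using smooth_numbers_Suc_I[of x j 0] by simp
qed

lemma one_in_smooth_numbers: "1 \<in> smooth_numbers j"
proof (induction j)
  case (Suc j)
  then show ?case using smooth_numbers_mono by blast
qed simp

lemma smooth_numbers_mult:
  "x \<in> smooth_numbers j \<Longrightarrow> y \<in> smooth_numbers j \<Longrightarrow> x * y \<in> smooth_numbers j"
proof (induction j arbitrary: x y)
  case (Suc j)
  obtain x' i where x: "x' \<in> smooth_numbers j" "x = x' * (j + 2) ^ i"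
    using Suc.prems(1) by (rule smooth_numbers_Suc_E)
  obtain y' k where y: "y' \<in> smooth_numbers j" "y = y' * (j + 2) ^ k"
    using Suc.prems(2) by (rule smooth_numbers_Suc_E)
  have "x * y = (x' * y') * (j + 2) ^ (i + k)"
    by (simp add: x y power_add mult_ac)
  then show ?case using smooth_numbers_Suc_I[OF Suc.IH[OF x(1) y(1)]] by metis
qed simp

lemma mem_smooth_numbers: "0 < n \<Longrightarrow> n \<le> Suc j \<Longrightarrow> n \<in> smooth_numbers j"
proof (induction j)
  case (Suc j)
  show ?case
  proof (cases "n = j + 2")
    case True
    then show ?thesis using smooth_numbers_Suc_I[OF one_in_smooth_numbers, of j 1] by simp
  next
    case False
    then have "n \<in> smooth_numbers j" using Suc by simp
    then show ?thesis using smooth_numbers_mono by blast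
  qed
qed simp

text \<open>The Euler product: each adjoined integer multiplies the bound by a geometric series. Composite integers produce
numbers repeatedly, which only increases the bound.\<close>
lemma smooth_numbers_sum_bound:
  assumes \<epsilon>: "\<epsilon> > 0"
  shows "\<exists>C. \<forall>F. finite F \<longrightarrow> F \<subseteq> smooth_numbers j \<longrightarrow> (\<Sum>n\<in>F. real n powr - \<epsilon>) \<le> C"
proof (induction j)
  case 0
  have "(\<Sum>n\<in>F. real n powr - \<epsilon>) \<le> 1" if "F \<subseteq> {1}" for F
    using that by (auto simp: subset_singleton_iff)
  then show ?case by (intro exI[of _ 1]) auto
next
  case (Suc j)
  then obtain C where C: "\<And>F. finite F \<Longrightarrow> F \<subseteq> smooth_numbers j \<Longrightarrow> (\<Sum>n\<in>F. real n powr - \<epsilon>) \<le> C"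
    by blast
  define \<rho> where "\<rho> = real (j + 2) powr - \<epsilon>"
  have \<rho>: "0 \<le> \<rho>" "\<rho> < 1" using \<epsilon> by (auto simp: \<rho>_def powr_less_one)
  show ?case
  proof (intro exI[of _ "C * (1 / (1 - \<rho>))"] allI impI)
    fix F assume F: "finite F" "F \<subseteq> smooth_numbers (Suc j)"
    let ?g = "\<lambda>(x, i). x * (j + 2) ^ i"
    obtain D where D: "D \<subseteq> smooth_numbers j \<times> UNIV" "finite D" "F = ?g ` D"
      using finite_subset_image[OF F(1)] F(2) by (metis smooth_numbers.simps(2))
    have "(\<Sum>n\<in>F. real n powr - \<epsilon>) \<le> (\<Sum>p\<in>D. real (?g p) powr - \<epsilon>)"
      unfolding D(3) by (rule order.trans[OF sum_image_le]) (use D(2) in auto)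
    also have "\<dots> = (\<Sum>(x, i)\<in>D. real x powr - \<epsilon> * \<rho> ^ i)"
    proof (intro sum.cong refl, clarify)
      fix x i
      have "(real (j + 2) ^ i) powr - \<epsilon> = \<rho> ^ i"
        by (simp add: \<rho>_def powr_powr mult.commute flip: powr_realpow)
      then show "real (x * (j + 2) ^ i) powr - \<epsilon> = real x powr - \<epsilon> * \<rho> ^ i"
        by (simp add: powr_mult)
    qed
    also have "\<dots> \<le> (\<Sum>(x, i)\<in>fst ` D \<times> snd ` D. real x powr - \<epsilon> * \<rho> ^ i)"
      using D(2) \<rho> by (intro sum_mono2) (auto simp: rev_image_eqI)
    also have "\<dots> = (\<Sum>x\<in>fst ` D. real x powr - \<epsilon>) * (\<Sum>i\<in>snd ` D. \<rho> ^ i)"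
      by (simp add: sum_product sum.cartesian_product)
    also have "\<dots> \<le> C * (1 / (1 - \<rho>))"
    proof (rule mult_mono)
      show "(\<Sum>x\<in>fst ` D. real x powr - \<epsilon>) \<le> C" using D by (intro C) auto
      show "0 \<le> C" using C[of "{}"] by simp
      show "(\<Sum>i\<in>snd ` D. \<rho> ^ i) \<le> 1 / (1 - \<rho>)"
        using sum_le_suminf[of "\<lambda>i. \<rho> ^ i" "snd ` D"] D(2) \<rho> suminf_geometric[of \<rho>] by simp
    qed (use \<rho> in \<open>auto intro!: sum_nonneg\<close>)
    finally show "(\<Sum>n\<in>F. real n powr - \<epsilon>) \<le> C * (1 / (1 - \<rho>))" .
  qed
qed

section \<open>Absolute convergence of the inverse\<close>

lemma dirichlet_inverse_support:
  assumes inv: "dirichlet_conv p u = dirichlet_one" and p1: "p 1 \<noteq> 0"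
    and p: "\<And>n. n > 0 \<Longrightarrow> p n \<noteq> 0 \<Longrightarrow> n \<in> smooth_numbers j"
  shows "n > 0 \<Longrightarrow> u n \<noteq> 0 \<Longrightarrow> n \<in> smooth_numbers j"
proof (induction n rule: less_induct)
  case (less n)
  show ?case
  proof (cases "n = 1")
    case False
    have "p 1 * u n + (\<Sum>d | d dvd n \<and> d \<noteq> 1. p d * u (n div d)) = 0"
      using dirichlet_conv_split[of n p u] less.prems(1) False inv by (simp add: dirichlet_one_def)
    then have "(\<Sum>d | d dvd n \<and> d \<noteq> 1. p d * u (n div d)) \<noteq> 0"
      using p1 less.prems(2) by auto
    then obtain d where d: "d dvd n" "d \<noteq> 1" "p d \<noteq> 0" "u (n div d) \<noteq> 0"
      by (auto elim!: sum.not_neutral_contains_not_neutral)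
    have "n div d < n" using div_proper_less[of n d] less.prems(1) d by simp
    moreover have "d > 0" "n div d > 0" using d(1) less.prems(1) by (auto simp: dvd_pos_nat dvd_div_eq_0_iff intro!: Nat.gr0I)
    ultimately have "d * (n div d) \<in> smooth_numbers j"
      using less.IH d p by (intro smooth_numbers_mult) auto
    then show ?thesis using d(1) by simp
  qed (simp only: one_in_smooth_numbers)
qed

lemma dirichlet_power_support:
  assumes u: "\<And>n. n > 0 \<Longrightarrow> u n \<noteq> 0 \<Longrightarrow> n \<in> smooth_numbers j"
  shows "n > 0 \<Longrightarrow> dirichlet_power u k n \<noteq> 0 \<Longrightarrow> n \<in> smooth_numbers j"
proof (induction k arbitrary: n)
  case 0
  then have "n = 1" by (simp add: dirichlet_one_def split: if_splits)
  then show ?case by (simp only: one_in_smooth_numbers)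
next
  case (Suc k)
  have "dirichlet_conv u (dirichlet_power u k) n \<noteq> 0" using Suc.prems(2) by simp
  then obtain d e where "n = d * e" "n > 0" "u d \<noteq> 0" "dirichlet_power u k e \<noteq> 0"
    by (rule dirichlet_conv_nonzeroE)
  then show ?case using u Suc.IH by (auto intro!: smooth_numbers_mult)
qed

text \<open>Where the first coefficient outweighs the others by a factor of two, the recursion for \<open>u\<close> bounds every partial
sum \<open>S\<close> of its norm by \<open>|f 1| * S \<le> 1 + |f 1| / 2 * S\<close>. Only finite sums of \<open>u\<close> enter,
so the bound yields convergence.\<close>
lemma abs_conv_inverse_far:
  assumes inv: "dirichlet_conv f u = dirichlet_one"
    and f: "abs_conv B f" and f1: "f 1 \<noteq> 0"
    and small: "dirichlet_norm B (\<lambda>n. if n \<le> 1 then 0 else f n) \<le> \<bar>f 1\<bar> / 2"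
  shows "abs_conv B u"
proof (rule abs_conv_bound(1))
  fix X
  define g where "g = (\<lambda>n. if n \<le> 1 then 0 else f n)"
  define v where "v = (\<lambda>n. if n \<le> X then u n else 0)"
  define S where "S = (\<Sum>n\<le>X. \<bar>u n\<bar> * real n powr - B)"
  have g: "abs_conv B g" unfolding g_def by (rule abs_conv_restrict'[OF f])
  have v: "abs_conv B v" by (rule abs_conv_finite_support[of X]) (simp add: v_def)
  have norm_v: "dirichlet_norm B v = S"
    unfolding dirichlet_norm_def S_def
    by (subst suminf_finite[of "{..X}"]) (auto simp: v_def)
  have gv: "abs_conv B (dirichlet_conv g v)" by (rule abs_conv_conv[OF g v])
  have S0: "S \<ge> 0" unfolding S_def by (intro sum_nonneg) auto
  have le: "\<bar>f 1\<bar> * (\<bar>u n\<bar> * real n powr - B)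
      \<le> \<bar>dirichlet_one n\<bar> * real n powr - B + \<bar>dirichlet_conv g v n\<bar> * real n powr - B"
    if "n \<le> X" for n
  proof (cases "n = 0")
    case False
    have "dirichlet_conv g v n = (\<Sum>d | d dvd n \<and> d \<noteq> 1. f d * u (n div d))"
    proof -
      have "dirichlet_conv g v n = (\<Sum>d | d dvd n \<and> d \<noteq> 1. g d * v (n div d))"
        using dirichlet_conv_split[of n g v] False by (simp add: g_def)
      also have "\<dots> = (\<Sum>d | d dvd n \<and> d \<noteq> 1. f d * u (n div d))"
      proof (intro sum.cong refl)
        fix d assume "d \<in> {d. d dvd n \<and> d \<noteq> 1}"
        then have d: "d dvd n" "d \<noteq> 1" by auto
        then have "d > 0" "n div d \<le> X"
          using False that order.trans[OF div_le_dividend[of n d]] by (auto simp: dvd_pos_nat)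
        then show "g d * v (n div d) = f d * u (n div d)" using d by (simp add: g_def v_def)
      qed
      finally show ?thesis .
    qed
    then have "f 1 * u n = dirichlet_one n - dirichlet_conv g v n"
      using dirichlet_conv_split[of n f u] False inv by simp
    then have "\<bar>f 1\<bar> * \<bar>u n\<bar> \<le> \<bar>dirichlet_one n\<bar> + \<bar>dirichlet_conv g v n\<bar>"
      by (simp flip: abs_mult)
    then have "\<bar>f 1\<bar> * \<bar>u n\<bar> * real n powr - B \<le> (\<bar>dirichlet_one n\<bar> + \<bar>dirichlet_conv g v n\<bar>) * real n powr - B"
      by (rule mult_right_mono) simp
    then show ?thesis by (simp add: algebra_simps)
  qed simp
  have "\<bar>f 1\<bar> * S \<le> (\<Sum>n\<le>X. \<bar>dirichlet_one n\<bar> * real n powr - B) + (\<Sum>n\<le>X. \<bar>dirichlet_conv g v n\<bar> * real n powr - B)"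
    unfolding S_def sum_distrib_left sum.distrib[symmetric] using le by (intro sum_mono) auto
  also have "\<dots> \<le> 1 + dirichlet_norm B g * S"
    using sum_le_dirichlet_norm[OF abs_conv_one, of "{..X}" B] sum_le_dirichlet_norm[OF gv, of "{..X}"]
      dirichlet_norm_conv_le[OF g v] by (simp add: dirichlet_norm_one norm_v)
  also have "\<dots> \<le> 1 + \<bar>f 1\<bar> / 2 * S"
    using small S0 by (intro add_left_mono mult_right_mono) (auto simp: g_def)
  finally show "(\<Sum>n\<le>X. \<bar>u n\<bar> * real n powr - B) \<le> 2 / \<bar>f 1\<bar>"
    using f1 unfolding S_def[symmetric] by (simp add: field_simps)
qed

text \<open>Far to the right, the \<open>k\<close>-th power of \<open>u\<close> has the sum \<open>1 / (D p)^k\<close>, which extends to a function bounded by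
\<open>(1 / \<mu>)^k\<close>. The coefficient estimate on an intermediate line \<open>Re s = \<sigma>2\<close> and the summability of
\<open>n powr (\<sigma>2 - \<sigma>)\<close> over the smooth numbers, which carry all the coefficients, give the bound. It is essential
that \<open>C\<close> does not depend on \<open>k\<close>.\<close>
lemma inverse_power_norm_bound:
  assumes fin: "\<And>n. n > N \<Longrightarrow> p n = 0" and p1: "p 1 \<noteq> 0"
    and inv: "dirichlet_conv p u = dirichlet_one"
    and \<sigma>: "\<sigma>1 < \<sigma>" and \<mu>: "\<mu> > 0" "\<And>s. Re s > \<sigma>1 \<Longrightarrow> norm (dseries p s) \<ge> \<mu>"
  obtains C where "C \<ge> 0"
    "\<And>k. abs_conv \<sigma> (dirichlet_power u k)" "\<And>k. dirichlet_norm \<sigma> (dirichlet_power u k) \<le> C * (1 / \<mu>) ^ k"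
proof -
  define \<sigma>2 where "\<sigma>2 = (\<sigma>1 + \<sigma>) / 2"
  have \<sigma>2: "\<sigma>1 < \<sigma>2" "\<sigma>2 < \<sigma>" using \<sigma> by (auto simp: \<sigma>2_def)
  have p: "abs_conv \<tau> p" for \<tau> by (rule abs_conv_finite_support[of N]) (rule fin)
  obtain B where B: "B \<ge> \<sigma>2" "dirichlet_norm B (\<lambda>n. if n \<le> 1 then 0 else p n) \<le> \<bar>p 1\<bar> / 2"
    using far_tail_small[OF p[of \<sigma>2], of "\<bar>p 1\<bar> / 2"] p1 by auto
  have u: "abs_conv B u" by (rule abs_conv_inverse_far[OF inv p p1 B(2)])
  have dseries_u: "dseries u s = 1 / dseries p s" if "Re s = B" for s
  proof -
    have "dseries p s \<noteq> 0" using that \<mu>(1) \<mu>(2)[of s] B(1) \<sigma>2 by auto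
    moreover have "dseries p s * dseries u s = 1"
      using dseries_conv[OF p u, of s] that by (simp add: inv dseries_one)
    ultimately show ?thesis by (simp add: eq_divide_eq mult.commute)
  qed
  have coeff: "\<bar>dirichlet_power u k n\<bar> \<le> (1 / \<mu>) ^ k * real n powr \<sigma>2" if "n > 0" for k n
  proof (rule coefficient_bound[OF abs_conv_power[OF u] _ \<sigma>2(1) B(1) _ _ that])
    have "dseries p s \<noteq> 0" if "Re s > \<sigma>1" for s using \<mu>(1) \<mu>(2)[OF that] by auto
    then show "(\<lambda>s. (1 / dseries p s) ^ k) holomorphic_on {s. Re s > \<sigma>1}"
      using dseries_holomorphic[OF p[of \<sigma>1]] by (auto intro!: holomorphic_intros)
    show "norm ((1 / dseries p s) ^ k) \<le> (1 / \<mu>) ^ k" if "Re s \<ge> \<sigma>2" for s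
      using \<mu>(1) \<mu>(2)[of s] that \<sigma>2 unfolding norm_power norm_divide
      by (intro power_mono) (auto intro!: divide_left_mono mult_pos_pos)
    show "(1 / dseries p s) ^ k = dseries (dirichlet_power u k) s" if "Re s = B" for s
      using dseries_power[OF u, of s k] dseries_u[OF that] that by simp
  qed
  have p_supp: "n \<in> smooth_numbers N" if "n > 0" "p n \<noteq> 0" for n
    using that fin[of n] by (cases "n > N") (auto intro!: mem_smooth_numbers)
  have supp: "n \<in> smooth_numbers N" if "n > 0" "dirichlet_power u k n \<noteq> 0" for k n
    using dirichlet_power_support[OF dirichlet_inverse_support[OF inv p1 p_supp] that] .
  obtain C where C: "\<And>F. finite F \<Longrightarrow> F \<subseteq> smooth_numbers N \<Longrightarrow> (\<Sum>n\<in>F. real n powr - (\<sigma> - \<sigma>2)) \<le> C"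
    using smooth_numbers_sum_bound[of "\<sigma> - \<sigma>2" N] \<sigma>2 by auto
  have C0: "C \<ge> 0" using C[of "{}"] by simp
  have bound: "(\<Sum>n\<le>X. \<bar>dirichlet_power u k n\<bar> * real n powr - \<sigma>) \<le> C * (1 / \<mu>) ^ k" for k X
  proof -
    have "(\<Sum>n\<le>X. \<bar>dirichlet_power u k n\<bar> * real n powr - \<sigma>)
        = (\<Sum>n\<in>{1..X} \<inter> smooth_numbers N. \<bar>dirichlet_power u k n\<bar> * real n powr - \<sigma>)"
    proof (rule sum.mono_neutral_right)
      show "\<forall>n\<in>{..X} - {1..X} \<inter> smooth_numbers N. \<bar>dirichlet_power u k n\<bar> * real n powr - \<sigma> = 0"
      proof
        fix n assume n: "n \<in> {..X} - {1..X} \<inter> smooth_numbers N"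
        then have "n = 0 \<or> dirichlet_power u k n = 0" using supp[of n k] by (cases "n = 0") auto
        then show "\<bar>dirichlet_power u k n\<bar> * real n powr - \<sigma> = 0" by auto
      qed
    qed auto
    also have "\<dots> \<le> (\<Sum>n\<in>{1..X} \<inter> smooth_numbers N. (1 / \<mu>) ^ k * real n powr - (\<sigma> - \<sigma>2))"
    proof (rule sum_mono)
      fix n assume n: "n \<in> {1..X} \<inter> smooth_numbers N"
      then have "\<bar>dirichlet_power u k n\<bar> * real n powr - \<sigma> \<le> ((1 / \<mu>) ^ k * real n powr \<sigma>2) * real n powr - \<sigma>"
        by (intro mult_right_mono coeff) auto
      also have "\<dots> = (1 / \<mu>) ^ k * real n powr - (\<sigma> - \<sigma>2)"
        using n by (simp add: mult.assoc flip: powr_add)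
      finally show "\<bar>dirichlet_power u k n\<bar> * real n powr - \<sigma> \<le> (1 / \<mu>) ^ k * real n powr - (\<sigma> - \<sigma>2)" .
    qed
    also have "\<dots> = (1 / \<mu>) ^ k * (\<Sum>n\<in>{1..X} \<inter> smooth_numbers N. real n powr - (\<sigma> - \<sigma>2))"
      by (simp add: sum_distrib_left)
    also have "\<dots> \<le> (1 / \<mu>) ^ k * C"
      using \<mu>(1) by (intro mult_left_mono C) auto
    finally show ?thesis by (simp add: mult_ac)
  qed
  show ?thesis
    by (rule that[OF C0 abs_conv_bound(1)[OF bound] abs_conv_bound(2)[OF bound]])
qed

lemma dirichlet_power_low_vanish:
  assumes q: "\<And>n. n < 2 \<Longrightarrow> q n = 0"
  shows "n < 2 ^ k \<Longrightarrow> dirichlet_power q k n = 0"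
proof (induction k arbitrary: n)
  case 0
  then show ?case by (simp add: dirichlet_one_def)
next
  case (Suc k)
  show ?case
  proof (rule ccontr)
    assume "dirichlet_power q (Suc k) n \<noteq> 0"
    then have "dirichlet_conv q (dirichlet_power q k) n \<noteq> 0" by simp
    then obtain d e where de: "n = d * e" "q d \<noteq> 0" "dirichlet_power q k e \<noteq> 0"
      by (rule dirichlet_conv_nonzeroE)
    have "d \<ge> 2" using de(2) q[of d] by (meson not_less)
    moreover have "e \<ge> 2 ^ k" using de(3) Suc.IH[of e] by (meson not_less)
    ultimately have "2 * 2 ^ k \<le> d * e" by (rule mult_le_mono)
    then show False using Suc.prems de(1) by simp
  qed
qed

text \<open>Iterating \<open>b = u + b * q * u\<close>, which is \<open>1 / f = 1 / p + q / (f * p)\<close> for \<open>p = f + q\<close>.\<close>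
lemma neumann_expansion:
  assumes b: "dirichlet_conv f b = dirichlet_one" "b 0 = 0"
    and u: "dirichlet_conv (\<lambda>n. f n + q n) u = dirichlet_one" "u 0 = 0"
  shows "b = (\<lambda>n. (\<Sum>k<K. dirichlet_conv (dirichlet_power q k) (dirichlet_power u (Suc k)) n)
           + dirichlet_conv b (dirichlet_conv (dirichlet_power q K) (dirichlet_power u K)) n)"
proof (induction K)
  case 0
  have "dirichlet_conv dirichlet_one dirichlet_one = dirichlet_one"
    by (rule dirichlet_conv_one_right) (simp add: dirichlet_one_def)
  then show ?case using dirichlet_conv_one_right[of b, OF b(2)] by simp
next
  case (Suc K)
  let ?R = "\<lambda>K. dirichlet_conv (dirichlet_power q K) (dirichlet_power u K)"
  have step: "b = (\<lambda>n. u n + dirichlet_conv b (dirichlet_conv q u) n)"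
  proof -
    have "b = dirichlet_conv b (dirichlet_conv (\<lambda>n. f n + q n) u)"
      using dirichlet_conv_one_right[of b, OF b(2)] u(1) by simp
    also have "dirichlet_conv (\<lambda>n. f n + q n) u = (\<lambda>n. dirichlet_conv u f n + dirichlet_conv u q n)"
      using dirichlet_conv_commute dirichlet_conv_add_right by metis
    also have "dirichlet_conv b \<dots> = (\<lambda>n. dirichlet_conv b (dirichlet_conv u f) n + dirichlet_conv b (dirichlet_conv u q) n)"
      by (rule dirichlet_conv_add_right)
    also have "dirichlet_conv b (dirichlet_conv u f) = dirichlet_conv u (dirichlet_conv f b)"
      by (simp only: dirichlet_conv_ac)
    also have "\<dots> = u" using b(1) dirichlet_conv_one_right[of u, OF u(2)] by simp
    finally show ?thesis by (simp only: dirichlet_conv_commute[of q u])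
  qed
  have "dirichlet_conv b (?R K) = dirichlet_conv (?R K) b"
    by (rule dirichlet_conv_commute)
  also have "\<dots> = dirichlet_conv (?R K) (\<lambda>n. u n + dirichlet_conv b (dirichlet_conv q u) n)"
    by (rule arg_cong[OF step])
  also have "\<dots> = (\<lambda>n. dirichlet_conv (?R K) u n + dirichlet_conv (?R K) (dirichlet_conv b (dirichlet_conv q u)) n)"
    by (rule dirichlet_conv_add_right)
  also have "dirichlet_conv (?R K) u = dirichlet_conv (dirichlet_power q K) (dirichlet_power u (Suc K))"
    by (simp add: dirichlet_conv_ac)
  also have "dirichlet_conv (?R K) (dirichlet_conv b (dirichlet_conv q u)) = dirichlet_conv b (?R (Suc K))"
    by (simp add: dirichlet_conv_ac)
  finally have split: "dirichlet_conv b (?R K)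
      = (\<lambda>n. dirichlet_conv (dirichlet_power q K) (dirichlet_power u (Suc K)) n + dirichlet_conv b (?R (Suc K)) n)" .
  show ?case
  proof
    fix n
    show "b n = (\<Sum>k<Suc K. dirichlet_conv (dirichlet_power q k) (dirichlet_power u (Suc k)) n)
        + dirichlet_conv b (?R (Suc K)) n"
      using fun_cong[OF Suc, of n] fun_cong[OF split, of n]
      by (simp only: sum.lessThan_Suc add.assoc)
  qed
qed

text \<open>Wiener's lemma for Dirichlet series. With \<open>q\<close> of norm at most \<open>\<delta> / 3\<close> and \<open>D p\<close> bounded below by \<open>2 * \<delta> / 3\<close>, the
\<open>k\<close>-th Neumann term has norm \<open>O((1 / 2)^k)\<close>. To avoid infinite sums of arithmetic functions, each partial sum of the
norm of \<open>b\<close> is compared with a finite Neumann sum: \<open>q^X\<close> vanishes below \<open>2^X > X\<close>, so the remainder does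
not affect the coefficients up to \<open>X\<close>.\<close>
theorem abs_conv_dirichlet_inverse:
  assumes f: "\<And>\<sigma>. \<sigma> > \<sigma>0 \<Longrightarrow> abs_conv \<sigma> f" and f1: "f 1 \<noteq> 0"
    and nz: "\<And>s. Re s > \<sigma>0 \<Longrightarrow> dseries f s \<noteq> 0" and \<sigma>: "\<sigma> > \<sigma>0"
  shows "abs_conv \<sigma> (dirichlet_inverse f)"
proof -
  \<comment> \<open>The zero-free half-plane is open: half of the distance to its boundary goes into the lower bound, the
      other half into the summation over smooth numbers.\<close>
  define \<sigma>1 where "\<sigma>1 = (\<sigma>0 + \<sigma>) / 2"
  have \<sigma>1: "\<sigma>0 < \<sigma>1" "\<sigma>1 < \<sigma>" using \<sigma> by (auto simp: \<sigma>1_def)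
  obtain \<delta> where \<delta>: "\<delta> > 0" "\<And>s. Re s \<ge> \<sigma>1 \<Longrightarrow> norm (dseries f s) \<ge> \<delta>"
    using dseries_bounded_below[OF f f1 nz \<sigma>1(1)] by auto
  obtain N where N: "N \<ge> 1" "dirichlet_norm \<sigma>1 (\<lambda>n. if n \<le> N then 0 else f n) \<le> \<delta> / 3"
    using small_tail[OF f[OF \<sigma>1(1)], of "\<delta> / 3" 1] \<delta>(1) by auto
  define t where "t = (\<lambda>n. if n \<le> N then 0 else f n)"
  define q where "q = (\<lambda>n. - t n)"
  define p where "p = (\<lambda>n. f n + q n)"
  have p_eq: "p = (\<lambda>n. if n \<le> N then f n else 0)" by (auto simp: p_def q_def t_def)
  have p1: "p 1 = f 1" using N(1) by (simp add: p_eq)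
  have t: "abs_conv \<sigma>1 t" unfolding t_def by (rule abs_conv_restrict'[OF f[OF \<sigma>1(1)]])
  have norm_q: "dirichlet_norm \<tau> q = dirichlet_norm \<tau> t" for \<tau> by (simp add: dirichlet_norm_def q_def)
  have q: "abs_conv \<sigma> q"
    using abs_conv_mono(1)[OF t, of \<sigma>] \<sigma>1 by (simp add: abs_conv_def q_def)
  have q_small: "dirichlet_norm \<sigma> q \<le> \<delta> / 3"
    using abs_conv_mono(2)[OF t, of \<sigma>] \<sigma>1 N(2) by (simp add: norm_q t_def)
  define b u where "b = dirichlet_inverse f" and "u = dirichlet_inverse p"
  have b: "dirichlet_conv f b = dirichlet_one" "b 0 = 0"
    using dirichlet_conv_inverse[of f] is_dirichlet_inverse_dirichlet_inverse(2)[of f] f1 by (auto simp: b_def)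
  have u: "dirichlet_conv p u = dirichlet_one" "u 0 = 0"
    using dirichlet_conv_inverse[of p] is_dirichlet_inverse_dirichlet_inverse(2)[of p] f1 p1 by (auto simp: u_def)
  have p_below: "norm (dseries p s) \<ge> 2 * \<delta> / 3" if "Re s > \<sigma>1" for s
  proof -
    have "dseries f s = dseries p s + dseries t s"
      using dseries_split[OF f[OF \<sigma>1(1)], of s "\<lambda>n. n \<le> N"] that by (simp add: p_eq t_def)
    then have "norm (dseries f s) \<le> norm (dseries p s) + norm (dseries t s)"
      by (simp add: norm_triangle_ineq)
    moreover have "norm (dseries t s) \<le> \<delta> / 3"
      using norm_dseries_le[OF t, of s] that N(2) by (simp add: t_def)
    ultimately show ?thesis using \<delta>(2)[of s] that by simp
  qed
  obtain C where C: "C \<ge> 0" "\<And>k. abs_conv \<sigma> (dirichlet_power u k)"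
    "\<And>k. dirichlet_norm \<sigma> (dirichlet_power u k) \<le> C * (1 / (2 * \<delta> / 3)) ^ k"
    using inverse_power_norm_bound[of N p u \<sigma>1 \<sigma> "2 * \<delta> / 3"] u(1) p1 f1 \<sigma>1(2) \<delta>(1) p_below
    by (auto simp: p_eq)
  let ?E = "\<lambda>k. dirichlet_conv (dirichlet_power q k) (dirichlet_power u (Suc k))"
  have E: "abs_conv \<sigma> (?E k)" for k
    by (rule abs_conv_conv[OF abs_conv_power[OF q] C(2)])
  define r where "r = 1 / (2 * \<delta> / 3)"
  have r0: "r \<ge> 0" using \<delta>(1) by (simp add: r_def)
  have norm_E: "dirichlet_norm \<sigma> (?E k) \<le> C * r * (1 / 2) ^ k" for k
  proof -
    have "dirichlet_norm \<sigma> (?E k) \<le> dirichlet_norm \<sigma> (dirichlet_power q k) * dirichlet_norm \<sigma> (dirichlet_power u (Suc k))"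
      by (rule dirichlet_norm_conv_le[OF abs_conv_power[OF q] C(2)])
    also have "\<dots> \<le> (\<delta> / 3) ^ k * (C * (1 / (2 * \<delta> / 3)) ^ Suc k)"
    proof (rule mult_mono[OF _ C(3)])
      show "dirichlet_norm \<sigma> (dirichlet_power q k) \<le> (\<delta> / 3) ^ k"
        by (rule order.trans[OF dirichlet_norm_power_le[OF q] power_mono[OF q_small dirichlet_norm_nonneg[OF q]]])
      show "0 \<le> dirichlet_norm \<sigma> (dirichlet_power u (Suc k))" by (rule dirichlet_norm_nonneg[OF C(2)])
    qed (use \<delta>(1) in simp)
    also have "\<dots> = C * r * ((\<delta> / 3) * r) ^ k"
      unfolding r_def[symmetric] power_mult_distrib power_Suc by (simp only: mult_ac)
    also have "(\<delta> / 3) * r = 1 / 2" using \<delta>(1) by (simp add: r_def)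
    finally show ?thesis .
  qed
  have "abs_conv \<sigma> b"
  proof (rule abs_conv_bound(1))
    fix X
    have lt: "X < 2 ^ X" by (rule less_exp)
    have b_eq: "b n = (\<Sum>k<X. ?E k n)" if "n \<le> X" for n
    proof -
      have "dirichlet_conv b (dirichlet_conv (dirichlet_power q X) (dirichlet_power u X)) n = 0"
      proof (rule ccontr)
        assume "\<not> ?thesis"
        then obtain d e where de: "n = d * e" "n > 0" "dirichlet_conv (dirichlet_power q X) (dirichlet_power u X) e \<noteq> 0"
          by (auto elim: dirichlet_conv_nonzeroE)
        from de(3) obtain x y where xy: "e = x * y" "dirichlet_power q X x \<noteq> 0"
          by (auto elim: dirichlet_conv_nonzeroE)
        have "q n = 0" if "n < 2" for n using that N(1) by (simp add: q_def t_def)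
        from dirichlet_power_low_vanish[of q, OF this, of x X] have "x \<ge> 2 ^ X" using xy(2) by (meson not_less)
        moreover have "x \<le> n" using de(1,2) xy(1) by (simp add: Suc_le_eq)
        ultimately show False using lt that by linarith
      qed
      then show ?thesis
        using fun_cong[OF neumann_expansion[OF b u[unfolded p_def], of X], of n] by simp
    qed
    have "(\<Sum>n\<le>X. \<bar>b n\<bar> * real n powr - \<sigma>) \<le> (\<Sum>n\<le>X. \<Sum>k<X. \<bar>?E k n\<bar> * real n powr - \<sigma>)"
    proof (rule sum_mono)
      fix n assume "n \<in> {..X}"
      then have "\<bar>b n\<bar> \<le> (\<Sum>k<X. \<bar>?E k n\<bar>)" by (simp only: b_eq atMost_iff sum_abs)
      then show "\<bar>b n\<bar> * real n powr - \<sigma> \<le> (\<Sum>k<X. \<bar>?E k n\<bar> * real n powr - \<sigma>)"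
        unfolding sum_distrib_right[symmetric] by (rule mult_right_mono) simp
    qed
    also have "\<dots> = (\<Sum>k<X. \<Sum>n\<le>X. \<bar>?E k n\<bar> * real n powr - \<sigma>)" by (rule sum.swap)
    also have "\<dots> \<le> (\<Sum>k<X. C * r * (1 / 2) ^ k)"
      by (intro sum_mono order.trans[OF sum_le_dirichlet_norm[OF E] norm_E]) simp
    also have "\<dots> = C * r * (\<Sum>k<X. (1 / 2) ^ k)" by (simp add: sum_distrib_left)
    also have "\<dots> \<le> C * r * 2"
    proof (rule mult_left_mono)
      show "(\<Sum>k<X. (1 / 2) ^ k) \<le> (2::real)"
        using sum_le_suminf[of "\<lambda>k. (1 / 2 :: real) ^ k" "{..<X}"] suminf_geometric[of "1 / 2 :: real"] by simp
    qed (use C(1) r0 in simp)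
    finally show "(\<Sum>n\<le>X. \<bar>b n\<bar> * real n powr - \<sigma>) \<le> C * r * 2" .
  qed
  then show ?thesis by (simp add: b_def)
qed

section \<open>Moments of a discrete law given by its characteristic function\<close>

text \<open>By Levy's uniqueness theorem, \<open>X\<close> has the law that puts mass \<open>w n\<close> on \<open>x n\<close>. Integrals
over this law are series, so absolute convergence of the series is integrability.\<close>
lemma discrete_law_expectation:
  fixes w x :: "nat \<Rightarrow> real" and h :: "real \<Rightarrow> real"
  assumes M: "prob_space M" and X: "X \<in> borel_measurable M"
    and w: "\<And>n. w n \<ge> 0" "w sums 1"
    and char: "\<And>t. char (distr M borel X) t = (\<Sum>n. of_real (w n) * iexp (t * x n))"
    and h: "h \<in> borel_measurable borel" and sm: "summable (\<lambda>n. \<bar>w n * h (x n)\<bar>)"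
  shows "integrable M (\<lambda>\<omega>. h (X \<omega>))" and "integral\<^sup>L M (\<lambda>\<omega>. h (X \<omega>)) = (\<Sum>n. w n * h (x n))"
proof -
  define N where "N = density (count_space UNIV) (\<lambda>n. ennreal (w n))"
  have "prob_space N"
  proof
    have "(\<Sum>n. ennreal (w n)) = ennreal (\<Sum>n. w n)"
      by (rule suminf_ennreal2) (use w in \<open>auto simp: sums_iff\<close>)
    then show "emeasure N (space N) = 1"
      using w(2) by (simp add: N_def emeasure_density nn_integral_count_space_nat sums_iff)
  qed
  then interpret N: prob_space N .
  interpret M: prob_space M by (rule M)
  have x: "x \<in> borel_measurable N" by (simp add: N_def)
  have "char (distr N borel x) = char (distr M borel X)"
  proof
    fix t
    have s: "summable (\<lambda>n. norm (w n *\<^sub>R iexp (t * x n)))"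
      using w by (simp add: sums_iff)
    have "char (distr N borel x) t = integral\<^sup>L N (\<lambda>n. iexp (t * x n))"
      unfolding char_def using x by (subst integral_distr) auto
    also have "\<dots> = (LINT n|count_space UNIV. w n *\<^sub>R iexp (t * x n))"
      unfolding N_def by (subst integral_density) (use w in auto)
    also have "\<dots> = (\<Sum>n. w n *\<^sub>R iexp (t * x n))"
      using s by (intro integral_count_space_nat) (simp add: integrable_count_space_nat_iff)
    finally show "char (distr N borel x) t = char (distr M borel X) t"
      by (simp add: char scaleR_conv_of_real)
  qed
  then have law: "distr N borel x = distr M borel X"
    by (intro Levy_uniqueness N.real_distribution_distr M.real_distribution_distr x X)
  have int: "integrable N (\<lambda>n. h (x n))"
    using sm w(1) unfolding N_def
    by (subst integrable_density) (auto simp: integrable_count_space_nat_iff)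
  have "integrable N (\<lambda>n. h (x n)) \<longleftrightarrow> integrable (distr N borel x) h"
    by (rule integrable_distr_eq[symmetric, OF x]) (use h in simp)
  also have "\<dots> \<longleftrightarrow> integrable M (\<lambda>\<omega>. h (X \<omega>))"
    unfolding law by (rule integrable_distr_eq[OF X]) (use h in simp)
  finally show "integrable M (\<lambda>\<omega>. h (X \<omega>))" using int by simp
  have "integral\<^sup>L M (\<lambda>\<omega>. h (X \<omega>)) = integral\<^sup>L (distr M borel X) h"
    by (rule integral_distr[symmetric, OF X]) (use h in simp)
  also have "\<dots> = integral\<^sup>L N (\<lambda>n. h (x n))"
    unfolding law[symmetric] by (rule integral_distr[OF x]) (use h in simp)
  also have "\<dots> = (LINT n|count_space UNIV. w n *\<^sub>R h (x n))"
    unfolding N_def by (subst integral_density) (use w in auto)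
  also have "\<dots> = (\<Sum>n. w n *\<^sub>R h (x n))"
    using sm by (intro integral_count_space_nat) (simp add: integrable_count_space_nat_iff)
  finally show "integral\<^sup>L M (\<lambda>\<omega>. h (X \<omega>)) = (\<Sum>n. w n * h (x n))" by simp
qed

section \<open>Mean and variance\<close>

lemma abs_conv_of_growth:
  assumes growth: "\<And>\<epsilon>::real. \<epsilon> > 0 \<Longrightarrow> a \<in> O(\<lambda>n. real n powr \<epsilon>)" and \<sigma>: "\<sigma> > 1"
  shows "abs_conv \<sigma> a"
  unfolding abs_conv_def
proof (rule summable_comparison_test_bigo)
  define \<epsilon> where "\<epsilon> = (\<sigma> - 1) / 2"
  show "summable (\<lambda>n. norm (real n powr (\<epsilon> - \<sigma>)))"
    using \<sigma> by (simp add: summable_real_powr_iff \<epsilon>_def field_simps)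
  have "(\<lambda>n. \<bar>a n\<bar>) \<in> O(\<lambda>n. real n powr \<epsilon>)"
    using growth[of \<epsilon>] \<sigma> by (simp add: \<epsilon>_def)
  then have "(\<lambda>n. \<bar>a n\<bar> * real n powr - \<sigma>) \<in> O(\<lambda>n. real n powr \<epsilon> * real n powr - \<sigma>)"
    by (intro landau_o.big.mult landau_o.big_refl)
  then show "(\<lambda>n. \<bar>a n\<bar> * real n powr - \<sigma>) \<in> O(\<lambda>n. real n powr (\<epsilon> - \<sigma>))"
    by (simp flip: powr_add)
qed

lemma Z_series_eq_dseries:
  assumes "abs_conv \<sigma> a" "\<sigma> \<le> Re s"
  shows "Z_series a s = dseries a s"
proof -
  have "(\<lambda>n. of_real (a (Suc n)) * of_nat (Suc n) powr - s) sums dseries a s"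
    using dseries_sums[OF assms] by (subst sums_Suc_iff) simp
  then show ?thesis by (simp add: Z_series_def sums_iff)
qed

text \<open>That is, \<open>A\<close> is the logarithmic derivative: \<open>D A = - Z' / Z\<close>.\<close>
lemma A_fun_conv:
  assumes "a 1 \<noteq> 0"
  shows "dirichlet_conv (A_fun a) a = log_twist a"
proof -
  have "dirichlet_conv (A_fun a) a = dirichlet_conv (log_twist a) (dirichlet_conv a (dirichlet_inverse a))"
    unfolding A_fun_def by (simp only: dirichlet_conv_ac)
  also have "\<dots> = log_twist a"
    unfolding dirichlet_conv_inverse[of a, OF assms] by (rule dirichlet_conv_one_right) (simp add: log_twist_def)
  finally show ?thesis .
qed

text \<open>The twist of \<open>A * a = a#\<close>, evaluated by the Leibniz rule.\<close>
lemma log_twist_A_fun_conv: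
  assumes "a 1 \<noteq> 0" "abs_conv \<sigma> (A_fun a)" "abs_conv \<sigma> (log_twist (A_fun a))" "abs_conv \<sigma> a" "abs_conv \<sigma> (log_twist a)"
  shows "dseries_real (log_twist (log_twist a)) \<sigma>
    = dseries_real (log_twist (A_fun a)) \<sigma> * dseries_real a \<sigma> + dseries_real (A_fun a) \<sigma> * dseries_real (log_twist a) \<sigma>"
proof -
  have eq: "log_twist (log_twist a) n = dirichlet_conv (log_twist (A_fun a)) a n + dirichlet_conv (A_fun a) (log_twist a) n" for n
    using log_twist_conv[of "A_fun a" a n] unfolding A_fun_conv[of a, OF assms(1)] .
  have "dseries_real (log_twist (log_twist a)) \<sigma>
    = dseries_real (dirichlet_conv (log_twist (A_fun a)) a) \<sigma> + dseries_real (dirichlet_conv (A_fun a) (log_twist a)) \<sigma>"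
    unfolding dseries_real_def eq distrib_right
    by (intro suminf_add[symmetric] dseries_real_summable abs_conv_conv assms)
  then show ?thesis by (simp only: dseries_real_conv[OF assms(3,4)] dseries_real_conv[OF assms(2,5)])
qed

lemma dseries_real_from_2:
  assumes f: "abs_conv \<sigma> f" and f1: "f 1 = 0"
  shows "(\<lambda>n. f (n + 2) / real (n + 2) powr \<sigma>) sums dseries_real f \<sigma>"
proof -
  have "(\<lambda>n. f n * real n powr - \<sigma>) sums dseries_real f \<sigma>"
    using dseries_real_summable[OF f] by (simp add: dseries_real_def summable_sums)
  then have "(\<lambda>n. f (n + 2) * real (n + 2) powr - \<sigma>) sums (dseries_real f \<sigma> - (\<Sum>n<2. f n * real n powr - \<sigma>))"
    by (rule sums_split_initial_segment)
  then show ?thesis using f1 by (simp add: numeral_2_eq_2 powr_minus_divide)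
qed

theorem theorem1p7:
  fixes a :: "nat \<Rightarrow> real"
    and M :: "real \<Rightarrow> 'w measure"
    and X :: "real \<Rightarrow> 'w \<Rightarrow> real"
    and \<sigma>0 :: real
  assumes a_1: "a 1 > 0"
    and a_nonneg: "\<And>n. n \<ge> 2 \<Longrightarrow> a n \<ge> 0"
    and a_growth: "\<And>\<epsilon>::real. \<epsilon> > 0 \<Longrightarrow> a \<in> O(\<lambda>n. real n powr \<epsilon>)"
    and prob: "\<And>\<sigma>. \<sigma> > 1 \<Longrightarrow> prob_space (M \<sigma>)"
    and rv: "\<And>\<sigma>. \<sigma> > 1 \<Longrightarrow> X \<sigma> \<in> borel_measurable (M \<sigma>)"
    and char_X: "\<And>\<sigma> t. \<sigma> > 1 \<Longrightarrow> char (distr (M \<sigma>) borel (X \<sigma>)) t = Z_normalized a \<sigma> t"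
    and \<sigma>0: "\<sigma>0 \<ge> 1"
    and nonzero: "\<And>\<sigma> t. \<sigma> > \<sigma>0 \<Longrightarrow> Z_normalized a \<sigma> t \<noteq> 0"
  shows "\<forall>\<sigma>>\<sigma>0.
      integrable (M \<sigma>) (X \<sigma>) \<and> integrable (M \<sigma>) (\<lambda>\<omega>. (X \<sigma> \<omega>)\<^sup>2) \<and>
      summable (\<lambda>n. A_fun a (n + 2) / real (n + 2) powr \<sigma>) \<and>
      prob_space.expectation (M \<sigma>) (X \<sigma>) = - (\<Sum>n. A_fun a (n + 2) / real (n + 2) powr \<sigma>) \<and>
      summable (\<lambda>n. A_fun a (n + 2) * ln (real (n + 2)) / real (n + 2) powr \<sigma>) \<and>
      prob_space.variance (M \<sigma>) (X \<sigma>) =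
        (\<Sum>n. A_fun a (n + 2) * ln (real (n + 2)) / real (n + 2) powr \<sigma>)"
proof (intro allI impI)
  fix \<sigma> assume \<sigma>: "\<sigma> > \<sigma>0"
  then have \<sigma>1: "\<sigma> > 1" using \<sigma>0 by simp
  have a1: "a 1 \<noteq> 0" using a_1 by simp
  have a: "abs_conv \<tau> a" if "\<tau> > 1" for \<tau>
    by (rule abs_conv_of_growth[OF a_growth that])
  have la: "abs_conv \<tau> (log_twist a)" if "\<tau> > 1" for \<tau>
    by (rule abs_conv_log_twist[OF a[of "(1 + \<tau>) / 2"]]) (use that in auto)
  have lla: "abs_conv \<tau> (log_twist (log_twist a))" if "\<tau> > 1" for \<tau>
    by (rule abs_conv_log_twist[OF la[of "(1 + \<tau>) / 2"]]) (use that in auto)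
  have nz: "dseries a s \<noteq> 0" if "Re s > \<sigma>0" for s
    using nonzero[OF that, of "Im s"] Z_series_eq_dseries[OF a[of "Re s"], of s] that \<sigma>0
    by (auto simp: Z_normalized_def)
  have A: "abs_conv \<tau> (A_fun a)" if "\<tau> > \<sigma>0" for \<tau>
    unfolding A_fun_def
  proof (rule abs_conv_conv)
    show "abs_conv \<tau> (log_twist a)" using la that \<sigma>0 by simp
    show "abs_conv \<tau> (dirichlet_inverse a)"
      by (rule abs_conv_dirichlet_inverse[of \<sigma>0, OF a a1 nz that]) (use \<sigma>0 in auto)
  qed
  have lA: "abs_conv \<sigma> (log_twist (A_fun a))"
    by (rule abs_conv_log_twist[OF A[of "(\<sigma>0 + \<sigma>) / 2"]]) (use \<sigma> in auto)
  define Z Z1 Z2 where "Z = dseries_real a \<sigma>"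
    and "Z1 = dseries_real (log_twist a) \<sigma>" and "Z2 = dseries_real (log_twist (log_twist a)) \<sigma>"
  have Z1: "Z1 = dseries_real (A_fun a) \<sigma> * Z"
    using dseries_real_conv[OF A[OF \<sigma>] a[OF \<sigma>1]] unfolding A_fun_conv[of a, OF a1] Z_def Z1_def .
  have Z2: "Z2 = dseries_real (log_twist (A_fun a)) \<sigma> * Z + dseries_real (A_fun a) \<sigma> * Z1"
    unfolding Z_def Z1_def Z2_def
    by (rule log_twist_A_fun_conv[of a, OF a1 A[OF \<sigma>] lA a[OF \<sigma>1] la[OF \<sigma>1]])
  have nonneg: "a n * real n powr - \<sigma> \<ge> 0" for n
    using a_1 a_nonneg[of n] by (cases "n = 0"; cases "n = 1") auto
  have sums_Z: "(\<lambda>n. a n * real n powr - \<sigma>) sums Z"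
    using dseries_real_summable[OF a[OF \<sigma>1]] by (simp add: Z_def dseries_real_def summable_sums)
  have "Z \<noteq> 0"
    using nz[of "of_real \<sigma>"] \<sigma> dseries_of_real[OF a[OF \<sigma>1]] by (auto simp: Z_def)
  moreover have "Z \<ge> 0" using sums_le[OF nonneg sums_zero sums_Z] .
  ultimately have Zpos: "Z > 0" by simp
  \<comment> \<open>The law of \<open>X \<sigma>\<close> will be the one with mass \<open>w n\<close> at \<open>- ln n\<close>.\<close>
  define w where "w = (\<lambda>n. a n * real n powr - \<sigma> / Z)"
  have w: "w n \<ge> 0" "w sums 1" for n
    using nonneg[of n] Zpos sums_divide[OF sums_Z, of Z] by (auto simp: w_def)
  have char: "char (distr (M \<sigma>) borel (X \<sigma>)) t = (\<Sum>n. of_real (w n) * iexp (t * - ln (real n)))" for t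
  proof -
    have summand: "of_real (a n) * of_nat n powr - Complex \<sigma> t / of_real Z = of_real (w n) * iexp (t * - ln (real n))" for n
    proof (cases "n = 0")
      case False
      have "of_nat n powr - Complex \<sigma> t = exp (of_real (- \<sigma> * ln (real n)) + \<i> * of_real (t * - ln (real n)))"
        using False by (simp add: powr_def Ln_of_nat complex_eq_iff Complex_eq algebra_simps)
      also have "\<dots> = of_real (real n powr - \<sigma>) * iexp (t * - ln (real n))"
        using False by (simp add: exp_add powr_def exp_of_real flip: of_real_minus of_real_mult)
      finally show ?thesis by (simp add: w_def)
    qed (simp add: w_def)
    have "char (distr (M \<sigma>) borel (X \<sigma>)) t = dseries a (Complex \<sigma> t) / of_real Z"
      unfolding char_X[OF \<sigma>1] Z_normalized_def
      using Z_series_eq_dseries[OF a[OF \<sigma>1]] dseries_of_real[OF a[OF \<sigma>1]] by (simp add: Z_def)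
    also have "\<dots> = (\<Sum>n. of_real (a n) * of_nat n powr - Complex \<sigma> t / of_real Z)"
      using sums_divide[OF dseries_sums[OF a[OF \<sigma>1], of "Complex \<sigma> t"], of "of_real Z"] by (simp add: sums_iff)
    finally show ?thesis by (simp only: summand)
  qed
  note law = discrete_law_expectation[OF prob[OF \<sigma>1] rv[OF \<sigma>1] w char]
  interpret prob_space "M \<sigma>" by (rule prob[OF \<sigma>1])
  have t1: "w n * - ln (real n) = - (log_twist a n * real n powr - \<sigma>) / Z" for n
    by (simp add: w_def log_twist_def)
  have t2: "w n * (- ln (real n))\<^sup>2 = log_twist (log_twist a) n * real n powr - \<sigma> / Z" for n
    by (simp add: w_def log_twist_def power2_eq_square)
  have s1: "(\<lambda>n. log_twist a n * real n powr - \<sigma>) sums Z1"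
    using dseries_real_summable[OF la[OF \<sigma>1]] by (simp add: Z1_def dseries_real_def summable_sums)
  have s2: "(\<lambda>n. log_twist (log_twist a) n * real n powr - \<sigma>) sums Z2"
    using dseries_real_summable[OF lla[OF \<sigma>1]] by (simp add: Z2_def dseries_real_def summable_sums)
  have abs1: "summable (\<lambda>n. \<bar>w n * - ln (real n)\<bar>)"
    unfolding t1 using la[OF \<sigma>1] by (simp add: abs_conv_def abs_mult summable_divide)
  have abs2: "summable (\<lambda>n. \<bar>w n * (- ln (real n))\<^sup>2\<bar>)"
    unfolding t2 using lla[OF \<sigma>1] by (simp add: abs_conv_def abs_mult summable_divide)
  have ident: "(\<lambda>x. x) \<in> borel_measurable (borel :: real measure)" by simp
  have int1: "integrable (M \<sigma>) (X \<sigma>)" and E1: "expectation (X \<sigma>) = - Z1 / Z"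
    using law[of "\<lambda>x. x", OF ident abs1]
    unfolding t1 sums_unique[OF sums_divide[OF sums_minus[OF s1], of Z], symmetric] by simp_all
  have square: "(\<lambda>x. x\<^sup>2) \<in> borel_measurable (borel :: real measure)" by simp
  have int2: "integrable (M \<sigma>) (\<lambda>\<omega>. (X \<sigma> \<omega>)\<^sup>2)" and E2: "expectation (\<lambda>\<omega>. (X \<sigma> \<omega>)\<^sup>2) = Z2 / Z"
    using law[of "\<lambda>x. x\<^sup>2", OF square abs2]
    unfolding t2 sums_unique[OF sums_divide[OF s2, of Z], symmetric] by simp_all
  have var: "variance (X \<sigma>) = dseries_real (log_twist (A_fun a)) \<sigma>"
    using variance_eq[OF int1 int2] Zpos unfolding E1 E2 Z2 Z1
    by (simp add: field_simps power2_eq_square)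
  have A1: "A_fun a 1 = 0" by (simp add: A_fun_def dirichlet_conv_def log_twist_def)
  have sA: "(\<lambda>n. A_fun a (n + 2) / real (n + 2) powr \<sigma>) sums dseries_real (A_fun a) \<sigma>"
    by (rule dseries_real_from_2[OF A[OF \<sigma>] A1])
  have slA: "(\<lambda>n. A_fun a (n + 2) * ln (real (n + 2)) / real (n + 2) powr \<sigma>) sums dseries_real (log_twist (A_fun a)) \<sigma>"
    using dseries_real_from_2[OF lA] by (simp add: log_twist_def)
  have "expectation (X \<sigma>) = - dseries_real (A_fun a) \<sigma>"
    using E1 Z1 Zpos by simp
  then show "integrable (M \<sigma>) (X \<sigma>) \<and> integrable (M \<sigma>) (\<lambda>\<omega>. (X \<sigma> \<omega>)\<^sup>2) \<and>
      summable (\<lambda>n. A_fun a (n + 2) / real (n + 2) powr \<sigma>) \<and>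
      expectation (X \<sigma>) = - (\<Sum>n. A_fun a (n + 2) / real (n + 2) powr \<sigma>) \<and>
      summable (\<lambda>n. A_fun a (n + 2) * ln (real (n + 2)) / real (n + 2) powr \<sigma>) \<and>
      variance (X \<sigma>) = (\<Sum>n. A_fun a (n + 2) * ln (real (n + 2)) / real (n + 2) powr \<sigma>)"
    using int1 int2 var sums_unique[OF sA] sums_unique[OF slA] sums_summable[OF sA] sums_summable[OF slA]
    by simp
qed

end
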